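(* Let $\mu$ and $\mu_n$ ($n\ge1$) be centered probability measures on $\mathbb{R}$, none equal to $\delta_0$, such that $\mu_n\Rightarrow\mu$ (weak convergence) and $\int|x|\,\mu_n(dx)\to\int|x|\,\mu(dx)$. Let $\beta_n=\beta_{\mu_n}$ and $\beta=\beta_\mu$. Then $\tau_{\beta_n}\to\tau_\beta$ almost surely.
   Context: $W$ is a standard Brownian motion with $W_0=0$ and $S_t=\sup_{u\le t}W_u$. A probability measure $\mu$ is centered if $\int|x|\mu(dx)<\infty$ and $\int x\,\mu(dx)=0$. For such $\mu$ with $X_\mu\sim\mu$, let $C_\mu(x)=\mathbb{E}[(X_\mu-x)^+]$, $\hat x_\mu=\sup\{x:C_\mu(x)>0\}$. For $0\le x<\hat x_\mu$, $\beta_\mu(x)=\arg\min_{y<x}\frac{C_\mu(y)}{x-y}$ (the largest minimizer; $\beta_\mu(0)$ is the infimum of the support of $\mu$, possibly $-\infty$), and $\beta_\mu(x)=x$ for $x\ge\hat x_\mu$. For a nondecreasing function $\beta$ on $[0,\infty)$ with $\beta(x)\le x$, $\tau_\beta=\inf\{u:W_u\le\beta(S_u)\}$. ($\tau_{\beta_\mu}$ is the Azéma–Yor embedding of $\mu$.) *)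

theory Defs
  imports "HOL-Probability.Probability"
begin

text \<open>
  Time is the half-line \<open>t \<ge> 0\<close> inside the reals; nothing is assumed about \<open>W t\<close> for \<open>t < 0\<close>.
  The normalisation at time 0 and the continuity of paths are only required almost surely.
\<close>

locale standard_brownian_motion = prob_space M
  for M :: "'a measure" and W :: "real \<Rightarrow> 'a \<Rightarrow> real" +
  assumes measurable_W: "\<And>t. 0 \<le> t \<Longrightarrow> random_variable borel (W t)"
    and W_zero: "AE \<omega> in M. W 0 \<omega> = 0"
    and normal_increments:
      "\<And>s t. 0 \<le> s \<Longrightarrow> s < t \<Longrightarrow>
         distributed M lborel (\<lambda>\<omega>. W t \<omega> - W s \<omega>) (normal_density 0 (sqrt (t - s)))"
    and indep_increments:
      "\<And>(n::nat) (t::nat \<Rightarrow> real). 0 \<le> t 0 \<Longrightarrow> (\<forall>i<n. t i \<le> t (Suc i)) \<Longrightarrow>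
         indep_vars (\<lambda>_. borel) (\<lambda>i \<omega>. W (t (Suc i)) \<omega> - W (t i) \<omega>) {..<n}"
    and continuous_paths: "AE \<omega> in M. continuous_on {0..} (\<lambda>t. W t \<omega>)"

definition running_max :: "(real \<Rightarrow> 'a \<Rightarrow> real) \<Rightarrow> real \<Rightarrow> 'a \<Rightarrow> real" where
  "running_max W t \<omega> = (SUP u\<in>{0..t}. W u \<omega>)"

definition centered :: "real measure \<Rightarrow> bool" where
  "centered \<mu> \<longleftrightarrow> real_distribution \<mu> \<and> integrable \<mu> (\<lambda>x. x) \<and> (\<integral>x. x \<partial>\<mu>) = 0"

definition call_price :: "real measure \<Rightarrow> real \<Rightarrow> real" where
  "call_price \<mu> x = (\<integral>z. max (z - x) 0 \<partial>\<mu>)"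

definition call_sup :: "real measure \<Rightarrow> ereal" where
  "call_sup \<mu> = Sup (ereal ` {x. call_price \<mu> x > 0})"

definition slope_minimizers :: "real measure \<Rightarrow> real \<Rightarrow> real set" where
  "slope_minimizers \<mu> x =
     {y. y < x \<and> (\<forall>z<x. call_price \<mu> y / (x - y) \<le> call_price \<mu> z / (x - z))}"

text \<open>
  For centered \<open>\<mu>\<close> and \<open>0 < x < call_sup \<mu>\<close> the set of minimizers is nonempty and compact, so that
  the supremum below is the largest minimizer. For centered \<open>\<mu>\<close> other than the point mass at 0,
  and \<open>x = 0\<close>, the quotient is at least 1, with equality exactly for those \<open>y < 0\<close> that bound the
  support of \<open>\<mu>\<close> from below; so the supremum is the infimum of the support, and it is
  \<open>-\<infinity>\<close>, the supremum of the empty set, if the support is unbounded below.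
  Only arguments \<open>x \<ge> 0\<close> are meaningful.
\<close>

definition ay_beta :: "real measure \<Rightarrow> real \<Rightarrow> ereal" where
  "ay_beta \<mu> x =
     (if ereal x < call_sup \<mu> then Sup (ereal ` slope_minimizers \<mu> x) else ereal x)"

text \<open>The infimum of the empty set of times is \<open>\<infinity>\<close>.\<close>

definition barrier_time :: "(real \<Rightarrow> 'a \<Rightarrow> real) \<Rightarrow> (real \<Rightarrow> ereal) \<Rightarrow> 'a \<Rightarrow> ereal" where
  "barrier_time W \<beta> \<omega> =
     Inf (ereal ` {u. 0 \<le> u \<and> ereal (W u \<omega>) \<le> \<beta> (running_max W u \<omega>)})"

end

theory Submission
  imports Defs
begin

text \<open>
  The measure \<open>\<mu>\<close> enters only through its call price function \<open>C\<close>, which is convex, nonincreasing and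
  1-Lipschitz. Since \<open>(z - x)\<^sup>+ - z\<^sup>+\<close> is bounded and continuous in \<open>z\<close>, and since the mean of \<open>z\<^sup>+\<close> under
  a centered measure is half the first absolute moment, the hypotheses give \<open>C\<^sub>n \<longlongrightarrow> C\<close> pointwise
  (\<open>call_price_tendsto\<close>). The claim then splits into two one-sided estimates along a fixed path \<open>w\<close>
  with running maximum \<open>S\<close>. The slope at \<open>s\<close> is the function \<open>y \<mapsto> C(y) / (s - y)\<close>;
  for \<open>s > 0\<close> the barrier \<open>\<beta>(s)\<close> is its largest minimizer if \<open>C(s) > 0\<close>, and \<open>\<beta>(s) = s\<close> if \<open>C(s) = 0\<close>.

  \<^emph>\<open>The stopping times do not come too early.\<close> If the path stays above the barrier \<open>\<beta>(S)\<close> on \<open>[0, t]\<close>,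
  then eventually it stays above \<open>\<beta>\<^sub>n(S)\<close> there. Otherwise a compactness argument produces times
  \<open>u\<^sub>n \<longlongrightarrow> u\<close> and minimizers of the \<open>n\<close>-th slope at \<open>S(u\<^sub>n)\<close> that are almost as large as \<open>w(u\<^sub>n)\<close>; a limit point
  of these is a minimizer of the limiting slope at \<open>S(u)\<close>, so the path meets the barrier at \<open>u\<close>
  (\<open>eventually_above_barrier\<close>). This part uses only continuity of the path.

  \<^emph>\<open>The stopping times do not come too late.\<close> If the limiting slope at \<open>S(v)\<close> takes a smaller
  value at some point between \<open>w(v)\<close> and \<open>S(v)\<close> than at \<open>w(v)\<close>, then quasiconvexity gives
  \<open>w(v) \<le> \<beta>\<^sub>n(S(v))\<close> eventually (\<open>eventually_ay_beta_ge\<close>).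
  So it suffices to find such a \<open>v\<close> immediately after the path meets the barrier. This can fail
  on exceptional paths, and \<open>\<beta>\<^sub>n\<close> need not converge to \<open>\<beta>\<close> at the jumps of \<open>\<beta>\<close> or beyond the right end
  \<open>a\<close> of the support of \<open>\<mu>\<close>. Three almost sure properties of Brownian motion remove the exceptions
  (\<open>eventually_hits_barrier\<close>):

    \<^item> The running maximum at rational times avoids any given countable set of levels, so the path
      never spends time below its maximum while that maximum is a jump of \<open>\<beta>\<close>.
    \<^item> The path has no local minimum whose value is exactly \<open>\<beta>\<close> of the current maximum.
    \<^item> After the first hit of \<open>a\<close> the path immediately goes above \<open>a\<close> and then below \<open>a\<close> again.

  The first two follow from one observation (\<open>AE_increment_not_limit\<close>): each exceptional event forces
  an increment of the path to equal a functional of the increments over disjoint time intervals,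
  hence a random variable independent of it; a normal variable has no atoms, so this has
  probability zero. Passing to the limit along time grids replaces measurability and
  independence statements about suprema by statements about finitely many increments.
  The third property is an instance of the strong Markov property, proved here by stopping at the
  first grid time above \<open>a\<close> (\<open>prob_stay_above_at_grid_hit\<close>) and by a bound, uniform in the starting time,
  on the probability that the path stays on one side of its present value (\<open>small_ball\<close>). The same bound
  gives the first property at level 0, where the maximum may be attained at time 0.
\<close>

section \<open>Call prices\<close>

lemma call_price_integrable:
  assumes "centered \<mu>"
  shows "integrable \<mu> (\<lambda>z. max (z - x) 0)"
proof -
  interpret real_distribution \<mu> using assms by (simp add: centered_def)
  have [simp]: "prob UNIV = 1" using prob_space by simp
  show ?thesis using assms by (intro integrable_max) (auto simp: centered_def)
qed

lemma call_price_nonneg: "0 \<le> call_price \<mu> x"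
  unfolding call_price_def by (rule integral_nonneg_AE) auto

lemma call_price_antimono:
  assumes "centered \<mu>" "x \<le> y"
  shows "call_price \<mu> y \<le> call_price \<mu> x"
  unfolding call_price_def using assms
  by (intro integral_mono call_price_integrable) auto

text \<open>
  The payoff dominates \<open>z - x\<close>, whose mean is \<open>- x\<close>.
\<close>

lemma call_price_ge_minus:
  assumes "centered \<mu>"
  shows "- x \<le> call_price \<mu> x"
proof -
  interpret real_distribution \<mu> using assms by (simp add: centered_def)
  have [simp]: "prob UNIV = 1" using prob_space by simp
  have "(\<integral>z. z - x \<partial>\<mu>) \<le> (\<integral>z. max (z - x) 0 \<partial>\<mu>)"
    using assms by (intro integral_mono call_price_integrable) (auto simp: centered_def)
  then show ?thesis
    using assms by (simp add: centered_def call_price_def)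
qed

lemma call_price_decrease_le:
  assumes "centered \<mu>" "x \<le> y"
  shows "call_price \<mu> x \<le> call_price \<mu> y + (y - x)"
proof -
  interpret real_distribution \<mu> using assms by (simp add: centered_def)
  have [simp]: "prob UNIV = 1" using prob_space by simp
  have "(\<integral>z. max (z - x) 0 \<partial>\<mu>) \<le> (\<integral>z. max (z - y) 0 + (y - x) \<partial>\<mu>)"
    using assms by (intro integral_mono call_price_integrable) 
     (auto intro!: call_price_integrable)
  also have "\<dots> = call_price \<mu> y + (y - x)"
    using call_price_integrable[OF assms(1)] by (simp add: call_price_def)
  finally show ?thesis by (simp add: call_price_def)
qed

lemma call_price_lipschitz:
  assumes "centered \<mu>"
  shows "\<bar>call_price \<mu> x - call_price \<mu> y\<bar> \<le> \<bar>x - y\<bar>"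
  using call_price_decrease_le[OF assms, of x y] call_price_decrease_le[OF assms, of y x]
    call_price_antimono[OF assms, of x y] call_price_antimono[OF assms, of y x]
  by linarith

lemma isCont_call_price:
  assumes "centered \<mu>"
  shows "isCont (call_price \<mu>) x"
proof -
  have "1-lipschitz_on UNIV (call_price \<mu>)"
    using call_price_lipschitz[OF assms] by (intro lipschitz_onI) (auto simp: dist_real_def)
  then show ?thesis
    using lipschitz_on_continuous_on continuous_on_eq_continuous_at open_UNIV by blast
qed

lemma call_price_convex:
  assumes "centered \<mu>"
  shows "convex_on UNIV (call_price \<mu>)"
proof (rule convex_onI)
  fix t x y :: real
  assume t: "0 < t" "t < 1"
  have *: "max (z - ((1 - t) * x + t * y)) 0 \<le> (1 - t) * max (z - x) 0 + t * max (z - y) 0" for z :: real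
  proof -
    have "z - ((1 - t) * x + t * y) = (1 - t) * (z - x) + t * (z - y)"
      by (simp add: algebra_simps)
    also have "\<dots> \<le> (1 - t) * max (z - x) 0 + t * max (z - y) 0"
      using t by (intro add_mono mult_left_mono) auto
    finally show ?thesis
      using t by (intro max.boundedI add_nonneg_nonneg mult_nonneg_nonneg) auto
  qed
  have "call_price \<mu> ((1 - t) * x + t * y) \<le> (\<integral>z. (1 - t) * max (z - x) 0 + t * max (z - y) 0 \<partial>\<mu>)"
    unfolding call_price_def using assms * by (intro integral_mono) (auto intro!: call_price_integrable)
  also have "\<dots> = (1 - t) * call_price \<mu> x + t * call_price \<mu> y"
    using call_price_integrable[OF assms] by (simp add: call_price_def)
  finally show "call_price \<mu> ((1 - t) *\<^sub>R x + t *\<^sub>R y) \<le> (1 - t) * call_price \<mu> x + t * call_price \<mu> y"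
    by simp
qed auto

lemma call_price_asymptote:
  assumes "centered \<mu>"
  shows "((\<lambda>x. call_price \<mu> x + x) \<longlongrightarrow> 0) at_bot"
proof -
  interpret real_distribution \<mu> using assms by (simp add: centered_def)
  have [simp]: "prob UNIV = 1" using prob_space by simp
  have int: "integrable \<mu> (\<lambda>z. z)" and mean: "(\<integral>z. z \<partial>\<mu>) = 0"
    using assms by (auto simp: centered_def)
  have eq: "call_price \<mu> x + x = (\<integral>z. max (z - x) 0 - (z - x) \<partial>\<mu>)" for x
    using call_price_integrable[OF assms] int
    by (simp add: call_price_def mean)
  have "((\<lambda>x. \<integral>z. max (z - (- x)) 0 - (z - (- x)) \<partial>\<mu>) \<longlongrightarrow> (\<integral>z. 0 \<partial>\<mu>)) at_top"
  proof (rule integral_dominated_convergence_at_top[where w="\<lambda>z. \<bar>z\<bar>"])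
    show "\<forall>\<^sub>F i::real in at_top. AE x in \<mu>. norm (max (x - - i) 0 - (x - - i)) \<le> \<bar>x\<bar>"
      using eventually_ge_at_top[of 0] by eventually_elim (auto intro!: AE_I2)
    show "AE x in \<mu>. ((\<lambda>i. max (x - - i) 0 - (x - - i)) \<longlongrightarrow> 0) at_top"
    proof (rule AE_I2)
      fix x :: real
      have "\<forall>\<^sub>F i in at_top. max (x - - i) 0 - (x - - i) = 0"
        using eventually_ge_at_top[of "-x"] by eventually_elim auto
      then show "((\<lambda>i. max (x - - i) 0 - (x - - i)) \<longlongrightarrow> 0) at_top"
        by (rule tendsto_eventually)
    qed
  qed (measurable, rule integrable_abs[OF int])
  then have "((\<lambda>x. call_price \<mu> (- x) + (- x)) \<longlongrightarrow> 0) at_top"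
    unfolding eq by simp
  then show ?thesis
    by (simp add: filterlim_at_bot_mirror)
qed

text \<open>
  Weak convergence alone does not control the unbounded payoff. Subtracting the payoff with strike 0
  leaves a bounded continuous function, and the price at strike 0 is half the first absolute moment
  because the positive and the negative part of a centered variable have the same mean.
\<close>

lemma call_price_tendsto:
  assumes cent: "\<And>n. centered (\<mu>s n)" "centered \<mu>"
    and weak: "weak_conv_m \<mu>s \<mu>"
    and moment: "(\<lambda>n. \<integral>z. \<bar>z\<bar> \<partial>\<mu>s n) \<longlonglongrightarrow> (\<integral>z. \<bar>z\<bar> \<partial>\<mu>)"
  shows "(\<lambda>n. call_price (\<mu>s n) x) \<longlonglongrightarrow> call_price \<mu> x"
proof -
  let ?f = "\<lambda>z. max (z - x) 0 - max z 0"
  have dist: "\<And>n. real_distribution (\<mu>s n)" "real_distribution \<mu>"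
    using cent by (auto simp: centered_def)
  have decomp: "call_price \<nu> x = (\<integral>z. ?f z \<partial>\<nu>) + (\<integral>z. \<bar>z\<bar> \<partial>\<nu>) / 2" if "centered \<nu>" for \<nu>
  proof -
    have "(\<integral>z. max z 0 \<partial>\<nu>) = (\<integral>z. (\<bar>z\<bar> + z) / 2 \<partial>\<nu>)"
      by (rule arg_cong[where f="integral\<^sup>L \<nu>"]) (auto simp: max_def)
    also have "\<dots> = (\<integral>z. \<bar>z\<bar> \<partial>\<nu>) / 2"
      using that by (simp add: centered_def)
    finally have "(\<integral>z. max z 0 \<partial>\<nu>) = (\<integral>z. \<bar>z\<bar> \<partial>\<nu>) / 2" .
    moreover have "integrable \<nu> (\<lambda>z. max z 0)"
      using call_price_integrable[OF that, of 0] by simp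
    ultimately show ?thesis
      using call_price_integrable[OF that, of x] by (simp add: call_price_def)
  qed
  have "(\<lambda>n. \<integral>z. ?f z \<partial>\<mu>s n) \<longlonglongrightarrow> (\<integral>z. ?f z \<partial>\<mu>)"
    by (rule weak_conv_imp_integral_bdd_continuous_conv[OF dist weak, where B="\<bar>x\<bar>"])
       (auto intro!: continuous_intros)
  from tendsto_add[OF this tendsto_divide[OF moment tendsto_const[of 2]]]
  show ?thesis
    by (simp add: decomp cent)
qed

text \<open>
  By continuity the set of strikes with positive price is open, so its supremum is not attained; the
  case distinction in \<open>ay_beta\<close> is therefore one between positive and vanishing prices.
\<close>

lemma less_call_sup_iff:
  assumes "centered \<mu>"
  shows "ereal x < call_sup \<mu> \<longleftrightarrow> call_price \<mu> x > 0"
proof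
  assume "ereal x < call_sup \<mu>"
  then obtain y where "x < y" "call_price \<mu> y > 0"
    by (auto simp: call_sup_def less_Sup_iff)
  then show "call_price \<mu> x > 0"
    using call_price_antimono[OF assms, of x y] by linarith
next
  assume pos: "call_price \<mu> x > 0"
  have "call_price \<mu> x \<le> call_price \<mu> (x + call_price \<mu> x / 2) + call_price \<mu> x / 2"
    using call_price_decrease_le[OF assms, of x "x + call_price \<mu> x / 2"] pos by simp
  then have "call_price \<mu> (x + call_price \<mu> x / 2) > 0"
    using pos by linarith
  then show "ereal x < call_sup \<mu>"
    unfolding call_sup_def less_Sup_iff using pos
    by (intro bexI[of _ "ereal (x + call_price \<mu> x / 2)"]) auto
qed

section \<open>The barrier function\<close>

text \<open>
  The quotient \<open>(s - y) / (s' - y)\<close> is decreasing in \<open>y\<close>. So passing from \<open>s\<close> to \<open>s'\<close> favours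
  larger \<open>y\<close>: every minimizer at \<open>s\<close> lies below every minimizer at \<open>s'\<close>. This strong form of
  monotonicity is also what makes two minimizers at the same \<open>s\<close> produce a jump of the barrier.
\<close>

lemma slope_minimizers_order:
  assumes C: "centered \<mu>" and "s < s'" and y: "y \<in> slope_minimizers \<mu> s" and y': "y' \<in> slope_minimizers \<mu> s'"
    and pos: "0 < call_price \<mu> s'"
  shows "y \<le> y'"
proof (rule ccontr)
  assume "\<not> y \<le> y'"
  then have lt: "y' < y" by simp
  have ys: "y < s" using y by (simp add: slope_minimizers_def)
  have pos': "0 < call_price \<mu> y'"
    using pos call_price_antimono[OF C, of y' s'] lt ys assms(2) by linarith
  have 1: "call_price \<mu> y / (s - y) \<le> call_price \<mu> y' / (s - y')"
    using y lt ys by (simp add: slope_minimizers_def)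
  have 2: "call_price \<mu> y' / (s' - y') \<le> call_price \<mu> y / (s' - y)"
    using y' lt ys assms(2) by (simp add: slope_minimizers_def)
  have "call_price \<mu> y * (s - y') \<le> call_price \<mu> y' * (s - y)"
    using 1 lt ys by (simp add: field_simps)
  moreover have "call_price \<mu> y' * (s' - y) \<le> call_price \<mu> y * (s' - y')"
    using 2 lt ys assms(2) by (simp add: field_simps)
  ultimately have "(call_price \<mu> y' * (s' - y)) * (s - y') \<le> (call_price \<mu> y' * (s - y)) * (s' - y')"
    using mult_right_mono[of "call_price \<mu> y' * (s' - y)" "call_price \<mu> y * (s' - y')" "s - y'"]
      mult_right_mono[of "call_price \<mu> y * (s - y')" "call_price \<mu> y' * (s - y)" "s' - y'"] lt ys assms(2)
    by (simp add: algebra_simps)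
  then have "call_price \<mu> y' * ((s' - y) * (s - y') - (s - y) * (s' - y')) \<le> 0"
    by (simp add: algebra_simps)
  moreover have "(s' - y) * (s - y') - (s - y) * (s' - y') = (s' - s) * (y - y')"
    by (simp add: algebra_simps)
  moreover have "0 < call_price \<mu> y' * ((s' - s) * (y - y'))"
    using pos' lt assms(2) by simp
  ultimately show False by simp
qed

text \<open>
  The slope tends to 1 at minus infinity and to infinity at \<open>s\<close>, and by the asymptote of the call price
  it takes a value \<open>c\<close> below 1; so the search can be restricted to a compact interval.
\<close>

lemma slope_minimizers_nonempty:
  assumes C: "centered \<mu>" and s: "0 < s" and pos: "0 < call_price \<mu> s"
  shows "slope_minimizers \<mu> s \<noteq> {}"
proof -
  let ?f = "\<lambda>y. call_price \<mu> y / (s - y)"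
  have "\<forall>\<^sub>F y in at_bot. call_price \<mu> y + y < s"
    using order_tendstoD(2)[OF call_price_asymptote[OF C] s] .
  moreover have "\<forall>\<^sub>F y::real in at_bot. y < 0"
    by (rule eventually_gt_at_bot)
  ultimately have "\<forall>\<^sub>F y in at_bot. call_price \<mu> y + y < s \<and> y < 0" by eventually_elim auto
  then obtain y0 where y0: "call_price \<mu> y0 + y0 < s" "y0 < 0"
    by (auto simp: eventually_at_bot_linorder)
  define c where "c = ?f y0"
  have c: "0 < c" "c < 1"
    using y0 s call_price_ge_minus[OF C, of y0] by (auto simp: c_def field_simps intro!: divide_pos_pos)
  \<comment> \<open>The second entry of \<open>K\<close> solves \<open>- y = c * (s - y)\<close> and that of \<open>b\<close> solves \<open>call_price \<mu> s = c * (s - y)\<close>;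
    outside \<open>[K, b]\<close> the quotient is therefore at least \<open>c\<close>.\<close>
  define K where "K = min y0 (- (c * s / (1 - c)))"
  define b where "b = max y0 (s - call_price \<mu> s / c)"
  have b: "b < s" "y0 \<le> b" using c pos y0 s by (auto simp: b_def)
  have left: "c \<le> ?f y" if "y < K" for y
  proof -
    have "y \<le> - (c * s / (1 - c))" using that by (simp add: K_def)
    then have "c * (s - y) \<le> - y"
      using c by (simp add: field_simps)
    also have "\<dots> \<le> call_price \<mu> y" by (rule call_price_ge_minus[OF C])
    finally show ?thesis using that y0 s by (simp add: K_def field_simps)
  qed
  have right: "c \<le> ?f y" if "b < y" "y < s" for y
  proof -
    have "s - call_price \<mu> s / c < y" using that by (simp add: b_def)
    then have "c * (s - y) \<le> call_price \<mu> s"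
      using c by (simp add: field_simps)
    also have "\<dots> \<le> call_price \<mu> y" using call_price_antimono[OF C, of y s] that by simp
    finally show ?thesis using that by (simp add: field_simps)
  qed
  have "continuous_on {K..b} ?f"
    using b isCont_call_price[OF C]
    by (intro continuous_intros continuous_at_imp_continuous_on) auto
  moreover have y0K: "y0 \<in> {K..b}" using b by (auto simp: K_def)
  ultimately obtain y where y: "y \<in> {K..b}" "\<And>z. z \<in> {K..b} \<Longrightarrow> ?f y \<le> ?f z"
    using continuous_attains_inf[of "{K..b}" ?f] by auto
  have "?f y \<le> ?f z" if "z < s" for z
    using y(2)[of z] y(2)[OF y0K] left[of z] right[of z] that c_def by fastforce
  then have "y \<in> slope_minimizers \<mu> s"
    using y b by (auto simp: slope_minimizers_def)
  then show ?thesis by auto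
qed

lemma ay_beta_le: "ay_beta \<mu> s \<le> ereal s"
  by (auto simp: ay_beta_def slope_minimizers_def intro!: Sup_least)

text \<open>
  The slope blows up at \<open>s\<close>, so its minimizers keep a positive distance from \<open>s\<close>. The distance comes from a
  comparison with the slope at \<open>s - 1\<close>.
\<close>

lemma ay_beta_less:
  assumes C: "centered \<mu>" and pos: "0 < call_price \<mu> s"
  shows "ay_beta \<mu> s < ereal s"
proof -
  let ?d = "call_price \<mu> s / call_price \<mu> (s - 1)"
  have pos1: "0 < call_price \<mu> (s - 1)"
    using pos call_price_antimono[OF C, of "s - 1" s] by simp
  have "y \<le> s - ?d" if "y \<in> slope_minimizers \<mu> s" for y
  proof -
    have "y < s" using that by (simp add: slope_minimizers_def)
    have "call_price \<mu> y / (s - y) \<le> call_price \<mu> (s - 1) / (s - (s - 1))"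
      using that unfolding slope_minimizers_def by (metis (no_types, lifting) mem_Collect_eq less_add_one diff_less_eq)
    then have "call_price \<mu> y \<le> call_price \<mu> (s - 1) * (s - y)" using \<open>y < s\<close> by (simp add: pos_divide_le_eq)
    moreover have "call_price \<mu> s \<le> call_price \<mu> y" using call_price_antimono[OF C, of y s] \<open>y < s\<close> by simp
    ultimately have "call_price \<mu> s \<le> call_price \<mu> (s - 1) * (s - y)" by simp
    then show ?thesis using pos1 by (simp add: field_simps)
  qed
  then have "ay_beta \<mu> s \<le> ereal (s - ?d)"
    using pos by (auto simp: ay_beta_def less_call_sup_iff[OF C] intro!: Sup_least)
  also have "\<dots> < ereal s" using pos pos1 by simp
  finally show ?thesis .
qed

lemma ay_beta_upper:
  assumes "centered \<mu>" "0 < call_price \<mu> s" "y \<in> slope_minimizers \<mu> s"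
  shows "ereal y \<le> ay_beta \<mu> s"
  using assms by (auto simp: ay_beta_def less_call_sup_iff intro!: Sup_upper)

lemma ay_beta_of_zero_price:
  assumes "centered \<mu>" "call_price \<mu> s = 0"
  shows "ay_beta \<mu> s = ereal s"
  using assms by (simp add: ay_beta_def less_call_sup_iff)

text \<open>
  The real-valued part of the barrier. Its value 0 outside the region where the barrier is a finite
  minimizer is a convention that keeps the function measurable.
\<close>

definition ay_level :: "real measure \<Rightarrow> real \<Rightarrow> real" where
  "ay_level \<mu> s = (if 0 < s \<and> 0 < call_price \<mu> s then real_of_ereal (ay_beta \<mu> s) else 0)"

lemma ay_beta_eq_level:
  assumes "centered \<mu>" "0 < s" "0 < call_price \<mu> s"
  shows "ay_beta \<mu> s = ereal (ay_level \<mu> s)"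
proof -
  obtain y where "y \<in> slope_minimizers \<mu> s"
    using slope_minimizers_nonempty[OF assms] by auto
  then have "ereal y \<le> ay_beta \<mu> s" using ay_beta_upper[OF assms(1,3)] by auto
  then show ?thesis
    using ay_beta_le[of \<mu> s] assms(2,3) by (cases "ay_beta \<mu> s") (auto simp: ay_level_def)
qed

lemma slope_minimizers_le_ay_beta:
  assumes C: "centered \<mu>" and "0 < s" "s < s'" "0 < call_price \<mu> s'" and y: "y \<in> slope_minimizers \<mu> s'"
  shows "ay_beta \<mu> s \<le> ereal y"
proof -
  have "0 < call_price \<mu> s" using assms call_price_antimono[OF C, of s s'] by simp
  then have "ay_beta \<mu> s = Sup (ereal ` slope_minimizers \<mu> s)"
    by (simp add: ay_beta_def less_call_sup_iff[OF C])
  also have "\<dots> \<le> ereal y"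
    using slope_minimizers_order[OF C \<open>s < s'\<close> _ y] assms by (intro Sup_least) auto
  finally show ?thesis .
qed

lemma mono_on_ay_level:
  assumes C: "centered \<mu>"
  shows "mono_on {s. 0 < s \<and> 0 < call_price \<mu> s} (ay_level \<mu>)"
proof (rule mono_onI)
  fix s s' assume s: "s \<in> {s. 0 < s \<and> 0 < call_price \<mu> s}" "s' \<in> {s. 0 < s \<and> 0 < call_price \<mu> s}" "s \<le> s'"
  show "ay_level \<mu> s \<le> ay_level \<mu> s'"
  proof (cases "s = s'")
    case False
    obtain y where y: "y \<in> slope_minimizers \<mu> s'"
      using slope_minimizers_nonempty[OF C, of s'] s by auto
    have "ay_beta \<mu> s \<le> ereal y" "ereal y \<le> ay_beta \<mu> s'"
      using slope_minimizers_le_ay_beta[OF C _ _ _ y, of s] ay_beta_upper[OF C _ y] s False by auto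
    then show ?thesis
      using ay_beta_eq_level[OF C, of s] ay_beta_eq_level[OF C, of s'] s
      by (metis (no_types, lifting) ereal_less_eq(3) mem_Collect_eq order_trans)
  qed simp
qed

lemma open_positive_price:
  assumes C: "centered \<mu>"
  shows "open {s. 0 < s \<and> 0 < call_price \<mu> s}"
proof -
  have "continuous_on UNIV (call_price \<mu>)"
    using isCont_call_price[OF C] by (simp add: continuous_at_imp_continuous_on)
  then show ?thesis
    by (intro open_Collect_conj open_Collect_less continuous_intros)
qed

lemma borel_measurable_ay_level [measurable]:
  assumes C: "centered \<mu>"
  shows "ay_level \<mu> \<in> borel_measurable borel"
proof -
  define A where "A = {s. 0 < s \<and> 0 < call_price \<mu> s}"
  have A: "A \<in> sets borel"
    unfolding A_def using open_positive_price[OF C] by (rule borel_open)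
  have "ay_level \<mu> \<in> borel_measurable (restrict_space borel A)"
    unfolding A_def by (rule borel_measurable_mono_on_fnc[OF mono_on_ay_level[OF C]])
  moreover have "ay_level \<mu> \<in> borel_measurable (restrict_space borel (- A))"
  proof (rule measurable_cong[THEN iffD2])
    show "ay_level \<mu> s = 0" if "s \<in> space (restrict_space borel (- A))" for s
      using that unfolding ay_level_def space_restrict_space A_def by auto
  qed simp
  ultimately show ?thesis
    using A by - (rule measurable_piecewise_restrict[of "{A, - A}"], auto)
qed

lemma countable_discontinuities_ay_level:
  assumes C: "centered \<mu>"
  shows "countable {s. 0 < s \<and> 0 < call_price \<mu> s \<and> \<not> isCont (ay_level \<mu>) s}"
  using mono_on_ctble_discont_open[OF open_positive_price[OF C] mono_on_ay_level[OF C]]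
  by (simp add: conj_assoc)

text \<open>
  Minimizers to the left of \<open>s\<close> lie below \<open>w\<close>, so left continuity of the barrier at \<open>s\<close> pushes its value, the
  largest minimizer at \<open>s\<close>, below \<open>w\<close> as well.
\<close>

lemma slope_minimizers_unique:
  assumes C: "centered \<mu>" and s: "0 < s" "0 < call_price \<mu> s"
    and cont: "isCont (ay_level \<mu>) s"
    and w: "w \<in> slope_minimizers \<mu> s"
  shows "ay_beta \<mu> s \<le> ereal w"
proof -
  let ?A = "{s. 0 < s \<and> 0 < call_price \<mu> s}"
  let ?g = "ay_level \<mu>"
  have "\<forall>\<^sub>F x in at_left s. x \<in> ?A"
    using s by (intro filter_leD[OF at_within_le_nhds eventually_nhds_in_open[OF open_positive_price[OF C]]]) simp
  moreover have "\<forall>\<^sub>F x in at_left s. x < s"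
    by (simp add: eventually_at_filter)
  ultimately have "\<forall>\<^sub>F x in at_left s. ?g x \<le> w"
  proof eventually_elim
    case (elim x)
    then have "ay_beta \<mu> x \<le> ereal w"
      using slope_minimizers_le_ay_beta[OF C _ _ s(2) w, of x] by auto
    moreover have "ay_beta \<mu> x = ereal (?g x)"
      using elim by (intro ay_beta_eq_level[OF C]) auto
    ultimately show ?case by (metis ereal_less_eq(3))
  qed
  moreover have "(?g \<longlongrightarrow> ?g s) (at_left s)"
    using cont unfolding isCont_def by (rule filterlim_mono) (auto intro: at_le)
  ultimately have "?g s \<le> w"
    by (intro tendsto_upperbound[where F="at_left s"]) auto
  then show ?thesis using ay_beta_eq_level[OF C s] by (metis ereal_less_eq(3))
qed

text \<open>
  A convex function divided by a positive affine function is quasiconvex: \<open>C \<le> m (s - \<cdot>)\<close> is preserved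
  under convex combinations.
\<close>

lemma quotient_quasiconvex:
  fixes C :: "real \<Rightarrow> real"
  assumes conv: "convex_on UNIV C" and "a < w" "w < b" "b < s"
  shows "C w / (s - w) \<le> max (C a / (s - a)) (C b / (s - b))"
proof -
  define m where "m = max (C a / (s - a)) (C b / (s - b))"
  define t where "t = (w - a) / (b - a)"
  have t: "0 \<le> t" "t \<le> 1" using assms by (auto simp: t_def)
  have w: "w = (1 - t) * a + t * b"
  proof -
    have "t * (b - a) = w - a" using assms by (simp add: t_def)
    then show ?thesis by (simp add: algebra_simps)
  qed
  have a: "C a \<le> m * (s - a)" and b: "C b \<le> m * (s - b)"
    using assms by (auto simp: m_def pos_divide_le_eq[symmetric])
  have "C w \<le> (1 - t) * C a + t * C b"
    using convex_onD[OF conv t, of a b] w by simp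
  also have "\<dots> \<le> (1 - t) * (m * (s - a)) + t * (m * (s - b))"
    using t a b by (intro add_mono mult_left_mono) auto
  also have "\<dots> = m * (s - w)" unfolding w by (simp add: algebra_simps)
  finally show ?thesis using assms by (simp add: m_def[symmetric] pos_divide_le_eq)
qed

text \<open>
  If the barrier of \<open>\<mu>s n\<close> at \<open>s\<close> were below \<open>w\<close>, quasiconvexity would make the slope at \<open>w\<close> at most the slope
  at \<open>y\<close>, which the strict inequality in the limit excludes. Comparing the slopes at two fixed points avoids
  following the minimizers of the approximating measures, which may escape to minus infinity.
\<close>

lemma eventually_ay_beta_ge:
  assumes cent: "\<And>n. centered (\<mu>s n)"
    and conv: "\<And>x. (\<lambda>n. call_price (\<mu>s n) x) \<longlonglongrightarrow> C x"
    and s: "0 < s" "w < y" "y < s" and less: "C y / (s - y) < C w / (s - w)"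
  shows "\<forall>\<^sub>F n in sequentially. ereal w \<le> ay_beta (\<mu>s n) s"
proof -
  have "(\<lambda>n. call_price (\<mu>s n) w / (s - w) - call_price (\<mu>s n) y / (s - y))
      \<longlonglongrightarrow> C w / (s - w) - C y / (s - y)"
    using s by (intro tendsto_intros conv) auto
  then have "\<forall>\<^sub>F n in sequentially. 0 < call_price (\<mu>s n) w / (s - w) - call_price (\<mu>s n) y / (s - y)"
    using less by (intro order_tendstoD(1)) auto
  then show ?thesis
  proof eventually_elim
    case (elim n)
    show ?case
    proof (cases "call_price (\<mu>s n) s > 0")
      case True
      obtain z where z: "z \<in> slope_minimizers (\<mu>s n) s"
        using slope_minimizers_nonempty[OF cent s(1) True] by auto
      have "w \<le> z"
      proof (rule ccontr)
        assume "\<not> w \<le> z"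
        then have "call_price (\<mu>s n) w / (s - w) \<le> max (call_price (\<mu>s n) z / (s - z)) (call_price (\<mu>s n) y / (s - y))"
          using s by (intro quotient_quasiconvex call_price_convex[OF cent]) auto
        also have "\<dots> = call_price (\<mu>s n) y / (s - y)"
          using z s by (simp add: slope_minimizers_def max_def)
        finally show False using elim by simp
      qed
      then show ?thesis using ay_beta_upper[OF cent True z]
        by (metis ereal_less_eq(3) order_trans)
    next
      case False
      then have "call_price (\<mu>s n) s = 0" using call_price_nonneg[of "\<mu>s n" s] by linarith
      then show ?thesis using ay_beta_of_zero_price[OF cent] s by simp
    qed
  qed
qed

section \<open>Continuous paths and the lower bound on the stopping times\<close>

definition path_max :: "(real \<Rightarrow> real) \<Rightarrow> real \<Rightarrow> real" where
  "path_max w t = (SUP u\<in>{0..t}. w u)"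

lemma running_max_eq_path_max: "running_max W t \<omega> = path_max (\<lambda>u. W u \<omega>) t"
  by (simp add: running_max_def path_max_def)

lemma SUP_interval_attained:
  fixes w :: "real \<Rightarrow> real"
  assumes "continuous_on {a..b} w" "a \<le> b"
  obtains u where "u \<in> {a..b}" "w u = (SUP x\<in>{a..b}. w x)" "\<And>x. x \<in> {a..b} \<Longrightarrow> w x \<le> w u"
proof -
  obtain u where u: "u \<in> {a..b}" "\<And>x. x \<in> {a..b} \<Longrightarrow> w x \<le> w u"
    using continuous_attains_sup[of "{a..b}" w] assms by auto
  have "(SUP x\<in>{a..b}. w x) = w u"
    using u by (intro cSup_eq_maximum) auto
  with u show thesis by (intro that[of u]) auto
qed

locale continuous_path =
  fixes w :: "real \<Rightarrow> real"
  assumes cont: "continuous_on {0..} w"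
begin

lemma cont_on: "0 \<le> a \<Longrightarrow> continuous_on {a..b} w"
  using cont by (rule continuous_on_subset) auto

lemma path_max_attained:
  assumes "0 \<le> t"
  obtains u where "0 \<le> u" "u \<le> t" "w u = path_max w t"
  by (rule SUP_interval_attained[OF cont_on[of 0 t] assms]) (auto simp: path_max_def intro: that)

lemma path_max_ge:
  assumes "0 \<le> u" "u \<le> t"
  shows "w u \<le> path_max w t"
proof -
  have "0 \<le> t" using assms by simp
  from SUP_interval_attained[OF cont_on[of 0 t] this] obtain v
    where "w v = (SUP x\<in>{0..t}. w x)" "\<And>x. x \<in> {0..t} \<Longrightarrow> w x \<le> w v" by auto
  then show ?thesis using assms by (auto simp: path_max_def)
qed

lemma path_max_mono:
  assumes "0 \<le> s" "s \<le> t"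
  shows "path_max w s \<le> path_max w t"
proof -
  obtain u where "0 \<le> u" "u \<le> s" "w u = path_max w s"
    by (rule path_max_attained[OF assms(1)])
  then show ?thesis using path_max_ge[of u t] assms by simp
qed

lemma path_max_less_iff:
  assumes "0 \<le> t"
  shows "path_max w t < a \<longleftrightarrow> (\<forall>u. 0 \<le> u \<and> u \<le> t \<longrightarrow> w u < a)"
proof -
  obtain u where u: "0 \<le> u" "u \<le> t" "w u = path_max w t"
    by (rule path_max_attained[OF assms])
  have "w v < a" if "path_max w t < a" "0 \<le> v" "v \<le> t" for v
    using path_max_ge[of v t] that by linarith
  then show ?thesis using u by auto
qed

lemma eventually_near:
  assumes "0 \<le> t" "w t < a"
  obtains d where "0 < d" "\<And>x. 0 \<le> x \<Longrightarrow> \<bar>x - t\<bar> < d \<Longrightarrow> w x < a"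
proof -
  have "(w \<longlongrightarrow> w t) (at t within {0..})"
    using cont assms(1) by (auto simp: continuous_on_def)
  then have "\<forall>\<^sub>F x in at t within {0..}. w x < a"
    using assms(2) by (rule order_tendstoD)
  then obtain d where "0 < d" and d: "\<And>x. x \<in> {0..} \<Longrightarrow> x \<noteq> t \<Longrightarrow> dist x t < d \<Longrightarrow> w x < a"
    unfolding eventually_at by blast
  have "w x < a" if "0 \<le> x" "\<bar>x - t\<bar> < d" for x
    using d[of x] that assms(2) by (cases "x = t") (simp_all add: dist_real_def)
  with \<open>0 < d\<close> show thesis by (rule that)
qed

lemma continuous_on_path_max: "continuous_on {0..} (path_max w)"
  unfolding continuous_on_def
proof (intro ballI order_tendstoI)
  fix t a assume t: "t \<in> {0::real..}" and a: "path_max w t < a"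
  have wa: "\<And>u. 0 \<le> u \<Longrightarrow> u \<le> t \<Longrightarrow> w u < a" using a t path_max_less_iff by auto
  obtain d where d: "0 < d" "\<And>x. 0 \<le> x \<Longrightarrow> \<bar>x - t\<bar> < d \<Longrightarrow> w x < a"
    using eventually_near[of t a] wa[of t] t by auto
  have "path_max w x < a" if "x \<in> {0..}" "dist x t < d" for x
  proof -
    have "w u < a" if "0 \<le> u" "u \<le> x" for u
      using that \<open>dist x t < d\<close> d(2)[of u] wa[of u] by (cases "u \<le> t") (auto simp: dist_real_def)
    then show ?thesis using path_max_less_iff[of x a] that by auto
  qed
  then show "\<forall>\<^sub>F x in at t within {0..}. path_max w x < a"
    using d(1) by (auto simp: eventually_at)
next
  fix t a assume t: "t \<in> {0::real..}" and a: "a < path_max w t"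
  obtain u where u: "0 \<le> u" "u \<le> t" "w u = path_max w t"
    using t by (auto intro: path_max_attained[of t])
  show "\<forall>\<^sub>F x in at t within {0..}. a < path_max w x"
  proof (cases "u = t")
    case True
    have "(w \<longlongrightarrow> w t) (at t within {0..})"
      using cont t by (auto simp: continuous_on_def)
    then have "\<forall>\<^sub>F x in at t within {0..}. a < w x"
      using a True u(3) by (intro order_tendstoD) auto
    moreover have "\<forall>\<^sub>F x in at t within {0..}. x \<in> {0..}"
      by (simp add: eventually_at_filter)
    ultimately show ?thesis
      by eventually_elim (use path_max_ge in force)
  next
    case False
    have "a < path_max w x" if "dist x t < t - u" for x
    proof -
      have "u \<le> x" using that by (simp add: dist_real_def abs_if split: if_splits)
      then show ?thesis using path_max_ge[of u x] u a by simp
    qed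
    then show ?thesis using False u by (auto simp: eventually_at intro!: exI[of _ "t - u"])
  qed
qed

end

lemma call_price_tendsto_moving:
  assumes cent: "\<And>n. centered (\<nu> n)"
    and conv: "\<And>x. (\<lambda>n. call_price (\<nu> n) x) \<longlonglongrightarrow> C x"
    and s: "s \<longlonglongrightarrow> x"
  shows "(\<lambda>n. call_price (\<nu> n) (s n)) \<longlonglongrightarrow> C x"
proof -
  have "(\<lambda>n. call_price (\<nu> n) (s n) - call_price (\<nu> n) x) \<longlonglongrightarrow> 0"
  proof (rule Lim_null_comparison)
    show "\<forall>\<^sub>F n in sequentially. norm (call_price (\<nu> n) (s n) - call_price (\<nu> n) x) \<le> \<bar>s n - x\<bar>"
      using call_price_lipschitz[OF cent] by simp
    show "(\<lambda>n. \<bar>s n - x\<bar>) \<longlonglongrightarrow> 0"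
      using tendsto_rabs[OF tendsto_diff[OF s tendsto_const[of x]]] by simp
  qed
  from tendsto_add[OF this conv[of x]] show ?thesis by simp
qed

text \<open>
  Limits of minimizers are minimizers. A positive limiting price at \<open>x\<close> keeps the limit \<open>z\<close> away from \<open>x\<close>,
  where the slope is not defined.
\<close>

lemma slope_minimizers_closed:
  assumes cent: "\<And>n. centered (\<nu> n)"
    and conv: "\<And>x. (\<lambda>n. call_price (\<nu> n) x) \<longlonglongrightarrow> call_price \<mu> x"
    and s: "s \<longlonglongrightarrow> x" and y: "y \<longlonglongrightarrow> z" and pos: "0 < call_price \<mu> x"
    and min: "\<And>n. y n \<in> slope_minimizers (\<nu> n) (s n)"
  shows "z \<in> slope_minimizers \<mu> x"
proof -
  let ?C = "\<lambda>n. call_price (\<nu> n)"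
  have ys: "y n < s n" for n using min by (simp add: slope_minimizers_def)
  \<comment> \<open>The minimality inequality, multiplied out so that it survives the limit even if \<open>z = x\<close>.\<close>
  have ineq: "call_price \<mu> z * (x - v) \<le> call_price \<mu> v * (x - z)" if "v < x" for v
  proof (rule LIMSEQ_le)
    show "(\<lambda>n. ?C n (y n) * (s n - v)) \<longlonglongrightarrow> call_price \<mu> z * (x - v)"
      by (intro tendsto_intros s call_price_tendsto_moving[OF cent conv y])
    show "(\<lambda>n. ?C n v * (s n - y n)) \<longlonglongrightarrow> call_price \<mu> v * (x - z)"
      by (intro tendsto_intros s y conv)
    have "\<forall>\<^sub>F n in sequentially. v < s n" using order_tendstoD(1)[OF s that] .
    then show "\<exists>N. \<forall>n\<ge>N. ?C n (y n) * (s n - v) \<le> ?C n v * (s n - y n)"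
      unfolding eventually_sequentially
    proof (elim ex_forward all_forward imp_forward)
      fix n assume "v < s n"
      then have "?C n (y n) / (s n - y n) \<le> ?C n v / (s n - v)"
        using min[of n] by (simp add: slope_minimizers_def)
      then show "?C n (y n) * (s n - v) \<le> ?C n v * (s n - y n)"
        using ys[of n] \<open>v < s n\<close> by (simp add: field_simps)
    qed
  qed
  have "z \<le> x" using ys by (intro LIMSEQ_le[OF y s]) (auto intro: less_imp_le)
  moreover have "z \<noteq> x"
    using ineq[of "x - 1"] pos by auto
  ultimately have "z < x" by simp
  moreover have "call_price \<mu> z / (x - z) \<le> call_price \<mu> v / (x - v)" if "v < x" for v
    using ineq[OF that] that \<open>z < x\<close> by (simp add: field_simps)
  ultimately show ?thesis by (auto simp: slope_minimizers_def)
qed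

text \<open>
  The numbers \<open>a n\<close> are bounded and lie below the barrier values; so minimizers that nearly realize these
  values are bounded on both sides and have a convergent subsequence, whose limit dominates \<open>b\<close>.
\<close>

lemma ay_beta_upper_semicontinuous:
  assumes cent: "\<And>n. centered (\<nu> n)" "centered \<mu>"
    and conv: "\<And>x. (\<lambda>n. call_price (\<nu> n) x) \<longlonglongrightarrow> call_price \<mu> x"
    and s: "s \<longlonglongrightarrow> x" and a: "a \<longlonglongrightarrow> b" and pos: "0 < call_price \<mu> x"
    and le: "\<And>n. ereal (a n) \<le> ay_beta (\<nu> n) (s n)"
  shows "ereal b \<le> ay_beta \<mu> x"
proof -
  have "\<forall>\<^sub>F n in sequentially. 0 < call_price (\<nu> n) (s n)"
    using call_price_tendsto_moving[OF cent(1) conv s] pos by (rule order_tendstoD)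
  then obtain K where K: "\<And>n. K \<le> n \<Longrightarrow> 0 < call_price (\<nu> n) (s n)"
    by (auto simp: eventually_sequentially)
  have "\<exists>y. y \<in> slope_minimizers (\<nu> (n + K)) (s (n + K)) \<and> a (n + K) - 1 / real (Suc n) < y" for n
  proof -
    have "ereal (a (n + K) - 1 / real (Suc n)) < ereal (a (n + K))" by simp
    also have "\<dots> \<le> Sup (ereal ` slope_minimizers (\<nu> (n + K)) (s (n + K)))"
      using le[of "n + K"] K[of "n + K"] by (simp add: ay_beta_def less_call_sup_iff cent)
    finally show ?thesis by (auto simp: less_Sup_iff)
  qed
  then obtain y where y: "\<And>n. y n \<in> slope_minimizers (\<nu> (n + K)) (s (n + K))"
      "\<And>n. a (n + K) - 1 / real (Suc n) < y n"
    by metis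
  have sK: "(\<lambda>n. s (n + K)) \<longlonglongrightarrow> x" and aK: "(\<lambda>n. a (n + K)) \<longlonglongrightarrow> b"
    using s a by (auto intro: LIMSEQ_ignore_initial_segment)
  have low: "(\<lambda>n. a (n + K) - 1 / real (Suc n)) \<longlonglongrightarrow> b"
    using tendsto_diff[OF aK LIMSEQ_inverse_real_of_nat] by (simp add: inverse_eq_divide)
  obtain B1 B2 where B: "\<And>n. \<bar>a (n + K) - 1 / real (Suc n)\<bar> \<le> B1" "\<And>n. \<bar>s (n + K)\<bar> \<le> B2"
    using Bseq_eq_bounded convergent_imp_Bseq[OF convergentI[OF low]] convergent_imp_Bseq[OF convergentI[OF sK]]
    unfolding Bseq_def real_norm_def by metis
  have "y n < s (n + K)" for n using y(1)[of n] by (simp add: slope_minimizers_def)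
  then have "y n \<in> {- B1..B2}" for n
    using y(2)[of n] B(1)[of n] B(2)[of n] by (smt (verit) atLeastAtMost_iff)
  then obtain z l where l: "strict_mono (l :: nat \<Rightarrow> nat)" "(y \<circ> l) \<longlonglongrightarrow> z"
    using compact_imp_seq_compact[OF compact_Icc[of "- B1" B2]] unfolding seq_compact_def by metis
  have "z \<in> slope_minimizers \<mu> x"
  proof (rule slope_minimizers_closed[where \<nu>="\<lambda>n. \<nu> (l n + K)" and s="\<lambda>n. s (l n + K)" and y="y \<circ> l"])
    show "(\<lambda>n. call_price (\<nu> (l n + K)) v) \<longlonglongrightarrow> call_price \<mu> v" for v
      using LIMSEQ_subseq_LIMSEQ[OF LIMSEQ_ignore_initial_segment[OF conv, of K] l(1)] by (simp add: o_def)
    show "(\<lambda>n. s (l n + K)) \<longlonglongrightarrow> x"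
      using LIMSEQ_subseq_LIMSEQ[OF sK l(1)] by (simp add: o_def)
  qed (use cent y l pos in auto)
  moreover have "b \<le> z"
  proof (rule LIMSEQ_le[OF _ l(2)])
    show "((\<lambda>n. a (n + K) - 1 / real (Suc n)) \<circ> l) \<longlonglongrightarrow> b"
      by (rule LIMSEQ_subseq_LIMSEQ[OF low l(1)])
    show "\<exists>N. \<forall>n\<ge>N. ((\<lambda>n. a (n + K) - 1 / real (Suc n)) \<circ> l) n \<le> (y \<circ> l) n"
      using y(2) by (intro exI[of _ 0]) (simp add: less_imp_le)
  qed
  ultimately show ?thesis
    using ay_beta_upper[OF cent(2) pos, of z] by (metis ereal_less_eq(3) order_trans)
qed

context continuous_path
begin

text \<open>
  Times at which the path is below infinitely many of the approximating barriers accumulate, and at an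
  accumulation point the path is below the limiting barrier by upper semicontinuity.
\<close>

lemma eventually_above_barrier:
  assumes cent: "\<And>n. centered (\<nu> n)" "centered \<mu>"
    and conv: "\<And>x. (\<lambda>n. call_price (\<nu> n) x) \<longlonglongrightarrow> call_price \<mu> x"
    and above: "\<And>u. 0 \<le> u \<Longrightarrow> u \<le> t \<Longrightarrow> ay_beta \<mu> (path_max w u) < ereal (w u)"
  shows "\<forall>\<^sub>F n in sequentially. \<forall>u. 0 \<le> u \<and> u \<le> t \<longrightarrow> ay_beta (\<nu> n) (path_max w u) < ereal (w u)"
proof (rule ccontr)
  assume "\<not> ?thesis"
  then have "\<exists>\<^sub>F n in sequentially. \<exists>u. 0 \<le> u \<and> u \<le> t \<and> ereal (w u) \<le> ay_beta (\<nu> n) (path_max w u)"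
    unfolding not_eventually by (rule frequently_elim1) (auto simp: not_less)
  then have "infinite {n. \<exists>u. 0 \<le> u \<and> u \<le> t \<and> ereal (w u) \<le> ay_beta (\<nu> n) (path_max w u)}"
    by (simp add: frequently_cofinite flip: cofinite_eq_sequentially)
  then obtain r where r: "strict_mono (r :: nat \<Rightarrow> nat)"
    and "\<And>k. r k \<in> {n. \<exists>u. 0 \<le> u \<and> u \<le> t \<and> ereal (w u) \<le> ay_beta (\<nu> n) (path_max w u)}"
    using infinite_enumerate by blast
  then have "\<forall>k. \<exists>u. 0 \<le> u \<and> u \<le> t \<and> ereal (w u) \<le> ay_beta (\<nu> (r k)) (path_max w u)"
    by simp
  then obtain u where u: "\<And>k. 0 \<le> u k" "\<And>k. u k \<le> t" "\<And>k. ereal (w (u k)) \<le> ay_beta (\<nu> (r k)) (path_max w (u k))"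
    by metis
  then have "\<forall>k. u k \<in> {0..t}" by auto
  then obtain v l where v: "v \<in> {0..t}" and l: "strict_mono (l :: nat \<Rightarrow> nat)" "(u \<circ> l) \<longlonglongrightarrow> v"
    using compact_imp_seq_compact[OF compact_Icc[of 0 t]] unfolding seq_compact_def by metis
  have lim: "(\<lambda>k. f (u (l k))) \<longlonglongrightarrow> f v" if "continuous_on {0..} f" for f :: "real \<Rightarrow> real"
    using continuous_on_tendsto_compose[OF that l(2)] u(1) v by (simp add: o_def)
  \<comment> \<open>A path whose maximum has reached the region of vanishing call price has met the barrier.\<close>
  have "0 < call_price \<mu> (path_max w v)"
  proof (rule ccontr)
    assume "\<not> 0 < call_price \<mu> (path_max w v)"
    then have zero: "call_price \<mu> (path_max w v) = 0" using call_price_nonneg[of \<mu> "path_max w v"] by linarith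
    obtain v' where v': "0 \<le> v'" "v' \<le> v" "w v' = path_max w v"
      using v by (auto intro: path_max_attained[of v])
    then have "path_max w v' = w v'" using path_max_ge[of v' v'] path_max_mono[of v' v] by auto
    then show False
      using above[of v'] v v' ay_beta_of_zero_price[OF cent(2) zero] by auto
  qed
  then have "ereal (w v) \<le> ay_beta \<mu> (path_max w v)"
  proof (rule ay_beta_upper_semicontinuous[rotated -2, where \<nu>="\<lambda>k. \<nu> (r (l k))"])
    show "(\<lambda>k. call_price (\<nu> (r (l k))) x) \<longlonglongrightarrow> call_price \<mu> x" for x
      using LIMSEQ_subseq_LIMSEQ[OF conv strict_mono_o[OF r l(1)]] by (simp add: o_def)
    show "(\<lambda>k. path_max w (u (l k))) \<longlonglongrightarrow> path_max w v" by (rule lim[OF continuous_on_path_max])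
    show "(\<lambda>k. w (u (l k))) \<longlonglongrightarrow> w v" by (rule lim[OF cont])
  qed (use cent u in auto)
  then show False using above[of v] v by (auto simp: not_less)
qed

end

section \<open>The upper bound on the stopping times\<close>

text \<open>
  The maximum over a grid with \<open>N + 1\<close> cells, so that no division by zero occurs.
\<close>

definition grid_max :: "(real \<Rightarrow> real) \<Rightarrow> real \<Rightarrow> real \<Rightarrow> nat \<Rightarrow> real" where
  "grid_max f a b N = Max ((\<lambda>i. f (a + (b - a) * real i / real (Suc N))) ` {..Suc N})"

lemma grid_max_tendsto_SUP:
  assumes ab: "a \<le> b" and cont: "continuous_on {a..b} f"
  shows "grid_max f a b \<longlonglongrightarrow> (SUP x\<in>{a..b}. f x)"
proof -
  obtain u where u: "u \<in> {a..b}" "f u = (SUP x\<in>{a..b}. f x)" "\<And>x. x \<in> {a..b} \<Longrightarrow> f x \<le> f u"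
    by (rule SUP_interval_attained[OF cont ab]) auto
  have in_ab: "a + (b - a) * real i / real (Suc N) \<in> {a..b}" if "i \<le> Suc N" for i N
  proof -
    have "(b - a) * real i \<le> (b - a) * real (Suc N)" using that ab by (intro mult_left_mono) auto
    then have "(b - a) * real i / real (Suc N) \<le> b - a" by (simp add: pos_divide_le_eq)
    moreover have "0 \<le> (b - a) * real i / real (Suc N)" using ab by simp
    ultimately show ?thesis by simp
  qed
  \<comment> \<open>The grid point next to a maximizer \<open>u\<close>; for \<open>a = b\<close> the quotient is 0 and the point is \<open>a\<close>.\<close>
  define k where "k N = nat \<lfloor>(u - a) / (b - a) * real (Suc N)\<rfloor>" for N
  define x where "x N = a + (b - a) * real (k N) / real (Suc N)" for N
  have frac: "0 \<le> (u - a) / (b - a)" "(u - a) / (b - a) \<le> 1" "(b - a) * ((u - a) / (b - a)) = u - a"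
    using u(1) by (auto simp: divide_le_eq)
  have k: "real (k N) \<le> (u - a) / (b - a) * real (Suc N)" "(u - a) / (b - a) * real (Suc N) < real (k N) + 1" for N
  proof -
    have "0 \<le> (u - a) / (b - a) * real (Suc N)" using frac by (intro mult_nonneg_nonneg) auto
    then show "real (k N) \<le> (u - a) / (b - a) * real (Suc N)" "(u - a) / (b - a) * real (Suc N) < real (k N) + 1"
      unfolding k_def by linarith+
  qed
  have kN: "k N \<le> Suc N" for N
  proof -
    have "(u - a) / (b - a) * real (Suc N) \<le> 1 * real (Suc N)" using frac by (intro mult_right_mono) auto
    then have "real (k N) \<le> real (Suc N)" using k(1)[of N] by simp
    then show ?thesis by linarith
  qed
  have close: "\<bar>x N - u\<bar> \<le> (b - a) / real (Suc N)" for N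
  proof -
    have "(b - a) * real (k N) \<le> (b - a) * ((u - a) / (b - a) * real (Suc N))"
         "(b - a) * ((u - a) / (b - a) * real (Suc N)) \<le> (b - a) * (real (k N) + 1)"
      using ab by (intro mult_left_mono k(1) less_imp_le[OF k(2)]; simp)+
    moreover have "(b - a) * ((u - a) / (b - a) * real (Suc N)) = (u - a) * real (Suc N)"
      using frac(3) by (metis mult.assoc)
    ultimately have "(b - a) * real (k N) / real (Suc N) \<le> u - a"
      "u - a \<le> ((b - a) * real (k N) + (b - a)) / real (Suc N)"
      by (simp_all add: pos_divide_le_eq pos_le_divide_eq distrib_left)
    then show ?thesis by (simp add: x_def add_divide_distrib abs_le_iff)
  qed
  have "(\<lambda>N. x N - u) \<longlonglongrightarrow> 0"
  proof (rule Lim_null_comparison[where g="\<lambda>N. (b - a) / real (Suc N)"])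
    show "\<forall>\<^sub>F N in sequentially. norm (x N - u) \<le> (b - a) / real (Suc N)" using close by simp
    show "(\<lambda>N. (b - a) / real (Suc N)) \<longlonglongrightarrow> 0"
      using tendsto_mult[OF tendsto_const[of "b - a"] LIMSEQ_inverse_real_of_nat] by (simp add: divide_inverse)
  qed
  then have "x \<longlonglongrightarrow> u" by (simp add: LIM_zero_iff)
  then have fx: "(\<lambda>N. f (x N)) \<longlonglongrightarrow> f u"
    by (rule continuous_on_tendsto_compose[OF cont _ u(1)]) (use in_ab[OF kN] in \<open>simp add: x_def\<close>)
  have "(\<lambda>N. grid_max f a b N) \<longlonglongrightarrow> f u"
  proof (rule tendsto_sandwich[OF _ _ fx tendsto_const])
    show "\<forall>\<^sub>F N in sequentially. f (x N) \<le> grid_max f a b N"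
      using kN by (auto simp: grid_max_def x_def intro!: always_eventually Max_ge)
    show "\<forall>\<^sub>F N in sequentially. grid_max f a b N \<le> f u"
      unfolding grid_max_def using u(3)[OF in_ab] by (intro always_eventually allI Max.boundedI) auto
  qed
  then show ?thesis using u(2) by simp
qed

lemma ereal_neg_less_call_sup:
  assumes "centered \<mu>" "x < 0"
  shows "ereal x < call_sup \<mu>"
  using call_price_ge_minus[OF assms(1), of x] assms by (simp add: less_call_sup_iff)

context continuous_path
begin

lemma first_hit:
  assumes "w 0 \<le> a" "0 \<le> u" "a \<le> w u"
  obtains h where "0 \<le> h" "h \<le> u" "w h = a" "\<And>v. 0 \<le> v \<Longrightarrow> v < h \<Longrightarrow> w v < a"
proof -
  let ?S = "{0..u} \<inter> w -` {a..}"
  have "closed ?S"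
    by (intro continuous_closed_preimage cont_on) auto
  then have "compact ?S"
    by (simp add: compact_eq_bounded_closed bounded_Int)
  moreover have "?S \<noteq> {}" using assms by auto
  ultimately obtain h where h: "h \<in> ?S" "\<And>v. v \<in> ?S \<Longrightarrow> h \<le> v"
    using compact_attains_inf[of ?S] by blast
  then obtain x where x: "0 \<le> x" "x \<le> h" "w x = a"
    using IVT'[of w 0 a h] assms cont_on[of 0 h] by auto
  have "h \<le> x" using x h(1) by (intro h(2)) auto
  then have "w h = a" using x by simp
  moreover have "w v < a" if "0 \<le> v" "v < h" for v
    using h(2)[of v] h(1) that by (cases "a \<le> w v") auto
  ultimately show thesis using h(1) by (intro that[of h]) auto
qed

text \<open>
  If the call price vanishes at the current maximum, the path has already hit the right end \<open>a\<close> of the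
  support; afterwards it exceeds \<open>a\<close> and dips below \<open>a\<close> again before time \<open>T\<close>, and at the dip the slope is
  positive while it vanishes at points between \<open>a\<close> and the maximum. Otherwise the maximum \<open>s\<close> is
  constant around \<open>u\<close>, hence not an exceptional level, and the path gets strictly below the barrier
  near \<open>u\<close>: if not, \<open>w u\<close> would be a local minimum with value exactly \<open>ay_level \<mu> s\<close>. That case is
  contradicted by the last assumption on the path, whose sequence converges to
  \<open>ay_level \<mu> s - w p - inf (w - w r)\<close> with the infimum over \<open>[r, q]\<close>.
\<close>

lemma eventually_hits_barrier:
  assumes cent: "\<And>n. centered (\<nu> n)" "centered \<mu>"
    and conv: "\<And>x. (\<lambda>n. call_price (\<nu> n) x) \<longlonglongrightarrow> call_price \<mu> x"
    and w0: "w 0 = 0"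
    and levels: "\<And>q s. q \<in> \<rat> \<Longrightarrow> 0 < q \<Longrightarrow>
        s = 0 \<or> call_sup \<mu> = ereal s \<or> (0 < s \<and> 0 < call_price \<mu> s \<and> \<not> isCont (ay_level \<mu>) s) \<Longrightarrow>
        path_max w q \<noteq> s"
    and returns: "\<And>h a d. call_sup \<mu> = ereal a \<Longrightarrow> 0 \<le> h \<Longrightarrow> w h = a \<Longrightarrow>
        (\<And>v. 0 \<le> v \<Longrightarrow> v < h \<Longrightarrow> w v < a) \<Longrightarrow> 0 < d \<Longrightarrow> \<exists>v. h < v \<and> v < h + d \<and> w v < a"
    and no_touch: "\<And>p r q. p \<in> \<rat> \<Longrightarrow> r \<in> \<rat> \<Longrightarrow> q \<in> \<rat> \<Longrightarrow> 0 \<le> p \<Longrightarrow> p < r \<Longrightarrow> r < q \<Longrightarrow>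
        \<not> (\<lambda>N. ay_level \<mu> (grid_max (\<lambda>x. w x - w 0) 0 p N) - (w p - w 0)
               + grid_max (\<lambda>x. w r - w x) r q N) \<longlonglongrightarrow> w r - w p"
    and u: "0 \<le> u" "u < T" "ereal (w u) \<le> ay_beta \<mu> (path_max w u)"
  shows "\<forall>\<^sub>F n in sequentially. \<exists>v. 0 \<le> v \<and> v < T \<and> ereal (w v) \<le> ay_beta (\<nu> n) (path_max w v)"
proof -
  define s where "s = path_max w u"
  have s0: "0 \<le> s" using path_max_ge[of 0 u] u w0 by (simp add: s_def)
  have *: ?thesis if v: "0 \<le> v" "v < T" and y: "w v < y" "y < path_max w v"
    and less: "call_price \<mu> y / (path_max w v - y) < call_price \<mu> (w v) / (path_max w v - w v)" 
    and pos: "0 < path_max w v" for v y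
    using eventually_ay_beta_ge[OF cent(1) conv pos y less]
    by (rule eventually_mono) (use v in blast)
  show ?thesis
  proof (cases "0 < call_price \<mu> s")
    case False
    then have "call_sup \<mu> \<le> ereal s" using less_call_sup_iff[OF cent(2), of s] by simp
    moreover have "ereal (-1) < call_sup \<mu>" by (rule ereal_neg_less_call_sup[OF cent(2)]) simp
    ultimately obtain a where a: "call_sup \<mu> = ereal a" "a \<le> s" by (cases "call_sup \<mu>") auto
    have a0: "0 \<le> a" using ereal_neg_less_call_sup[OF cent(2), of a] a by force
    obtain m where m: "0 \<le> m" "m \<le> u" "w m = s"
      using path_max_attained[OF u(1)] unfolding s_def by metis
    then obtain h where h: "0 \<le> h" "h \<le> m" "w h = a" "\<And>v. 0 \<le> v \<Longrightarrow> v < h \<Longrightarrow> w v < a"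
      using a0 a(2) w0 by (auto intro: first_hit[of a m])
    have "\<exists>v. h < v \<and> v < h + (T - h) \<and> w v < a"
      using h m u(2) by (intro returns[OF a(1)]) auto
    then obtain v where v: "h < v" "v < T" "w v < a" by auto
    obtain q where q: "q \<in> \<rat>" "h < q" "q < v" using Rats_dense_in_real[OF v(1)] by auto
    have "a \<le> path_max w q" using path_max_ge[of h q] h q by simp
    moreover have "path_max w q \<noteq> a" using q h a by (intro levels) auto
    moreover have "path_max w q \<le> path_max w v" using q h by (intro path_max_mono) auto
    ultimately have max: "a < path_max w v" by simp
    then obtain y where y: "a < y" "y < path_max w v" using dense by auto
    have "call_price \<mu> y = 0"
      using less_call_sup_iff[OF cent(2), of y] y a call_price_nonneg[of \<mu> y] by simp
    moreover have "0 < call_price \<mu> (w v)"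
      using less_call_sup_iff[OF cent(2), of "w v"] v a by simp
    ultimately show ?thesis
      using v y max a0 h by (intro *[of v y]) auto
  next
    case True
    have wu: "w u < s"
      using ay_beta_less[OF cent(2) True] u(3) by (simp flip: s_def) (meson ereal_less_eq(3) leD not_le order_le_less_trans)
    have "u \<noteq> 0"
    proof
      assume "u = 0"
      then show False using wu path_max_less_iff[of 0 s] unfolding s_def by auto
    qed
    then have "0 < u" using u by simp
    obtain d where d: "0 < d" "\<And>x. 0 \<le> x \<Longrightarrow> \<bar>x - u\<bar> < d \<Longrightarrow> w x < s"
      using eventually_near[OF u(1) wu] by metis
    obtain p where p: "p \<in> \<rat>" "max 0 (u - d) < p" "p < u"
      using Rats_dense_in_real[of "max 0 (u - d)" u] \<open>0 < u\<close> d by auto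
    obtain r where r: "r \<in> \<rat>" "p < r" "r < u" using Rats_dense_in_real[OF p(3)] by auto
    obtain q where q: "q \<in> \<rat>" "u < q" "q < min T (u + d)"
      using Rats_dense_in_real[of u "min T (u + d)"] u d by auto
    \<comment> \<open>A rational window around \<open>u\<close> in which the path stays below its maximum \<open>s\<close>.\<close>
    have below: "w x < s" if "p \<le> x" "x \<le> q" for x
      using that p q by (intro d(2)) auto
    have max_p: "s \<le> path_max w p"
    proof -
      obtain m where m: "0 \<le> m" "m \<le> u" "w m = s"
        using path_max_attained[OF u(1)] unfolding s_def by metis
      then have "m < p" using below[of m] q by force
      then show ?thesis using path_max_ge[of m p] m by simp
    qed
    have max_q: "path_max w q \<le> s"
    proof -
      obtain m where m: "0 \<le> m" "m \<le> q" "w m = path_max w q"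
        using path_max_attained[of q] u q by (metis less_imp_le order_trans)
      show ?thesis
      proof (cases "m \<le> u")
        case True then show ?thesis using path_max_ge[of m u] m by (simp add: s_def)
      next
        case False then show ?thesis using below[of m] m p by simp
      qed
    qed
    have max: "path_max w x = s" if "p \<le> x" "x \<le> q" for x
      using path_max_mono[of p x] path_max_mono[of x q] that p max_p max_q by simp
    have "path_max w q \<noteq> 0" using q u by (intro levels) auto
    then have "0 < s" using max[of q] s0 p q by simp
    have cont_s: "isCont (ay_level \<mu>) s"
      using levels[of q s] max[of q] \<open>0 < s\<close> True p q by fastforce
    have beta: "ay_beta \<mu> s = ereal (ay_level \<mu> s)"
      by (rule ay_beta_eq_level[OF cent(2) \<open>0 < s\<close> True])
    have "\<exists>v. r \<le> v \<and> v \<le> q \<and> w v < ay_level \<mu> s"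
    proof (rule ccontr)
      assume "\<not> ?thesis"
      then have ge: "\<And>v. r \<le> v \<Longrightarrow> v \<le> q \<Longrightarrow> ay_level \<mu> s \<le> w v" by (meson not_le)
      then have "w u = ay_level \<mu> s"
        using ge[of u] u(3) r q beta by (intro antisym) (simp_all flip: s_def)
      then have "(SUP x\<in>{r..q}. w r - w x) = w r - ay_level \<mu> s"
        using ge r q by (intro cSup_eq_maximum) (auto intro!: image_eqI[of _ _ u])
      moreover have "continuous_on {r..q} (\<lambda>x. w r - w x)"
        using p r by (intro continuous_intros cont_on) auto
      then have "grid_max (\<lambda>x. w r - w x) r q \<longlonglongrightarrow> (SUP x\<in>{r..q}. w r - w x)"
        using r q by (intro grid_max_tendsto_SUP) auto
      ultimately have lim1: "(\<lambda>N. grid_max (\<lambda>x. w r - w x) r q N) \<longlonglongrightarrow> w r - ay_level \<mu> s" by simp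
      have "grid_max w 0 p \<longlonglongrightarrow> path_max w p"
        unfolding path_max_def using p by (intro grid_max_tendsto_SUP cont_on) auto
      then have "(\<lambda>N. grid_max (\<lambda>x. w x - w 0) 0 p N) \<longlonglongrightarrow> s"
        using max[of p] p q by (simp add: w0)
      then have "(\<lambda>N. ay_level \<mu> (grid_max (\<lambda>x. w x - w 0) 0 p N)) \<longlonglongrightarrow> ay_level \<mu> s"
        by (rule isCont_tendsto_compose[OF cont_s])
      from tendsto_add[OF tendsto_diff[OF this tendsto_const[of "w p - w 0"]] lim1]
      have "(\<lambda>N. ay_level \<mu> (grid_max (\<lambda>x. w x - w 0) 0 p N) - (w p - w 0)
               + grid_max (\<lambda>x. w r - w x) r q N) \<longlonglongrightarrow> w r - w p"
        by (simp add: w0)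
      then show False using no_touch[of p r q] p q r by auto
    qed
    then obtain v where v: "r \<le> v" "v \<le> q" "w v < ay_level \<mu> s" by auto
    have maxv: "path_max w v = s" using v r by (intro max) auto
    have "ereal (w v) < Sup (ereal ` slope_minimizers \<mu> s)"
      using v(3) beta True by (simp add: ay_beta_def less_call_sup_iff[OF cent(2)])
    then obtain y where y: "y \<in> slope_minimizers \<mu> s" "w v < y"
      by (auto simp: less_Sup_iff)
    have ys: "y < s" using y(1) by (simp add: slope_minimizers_def)
    have "w v \<notin> slope_minimizers \<mu> s"
      using slope_minimizers_unique[OF cent(2) \<open>0 < s\<close> True cont_s, of "w v"] v(3) beta by auto
    then obtain z where z: "z < s" "call_price \<mu> z / (s - z) < call_price \<mu> (w v) / (s - w v)"
      using y(2) ys by (auto simp: slope_minimizers_def not_le)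
    have "call_price \<mu> y / (s - y) \<le> call_price \<mu> z / (s - z)"
      using y(1) z(1) by (simp add: slope_minimizers_def)
    then have "call_price \<mu> y / (s - y) < call_price \<mu> (w v) / (s - w v)"
      using z(2) by simp
    then show ?thesis
      using y ys v p q r \<open>0 < s\<close> by (intro *[of v y]) (auto simp: maxv)
  qed
qed

end

section \<open>Independence of increments and normal variables\<close>

text \<open>
  By Fatou's lemma the event that all but finitely many of the \<open>E N\<close> occur has probability at most \<open>\<kappa>\<close>.
  Covering the exceptional set, instead of measuring it, allows properties \<open>P\<close> that quantify over
  uncountably many times.
\<close>

lemma (in prob_space) AE_if_eventually_in_small_events:
  assumes small: "\<And>\<kappa>. 0 < \<kappa> \<Longrightarrow> \<exists>E. (\<forall>N. E N \<in> events \<and> prob (E N) \<le> \<kappa>) \<and>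
      (AE \<omega> in M. \<not> P \<omega> \<longrightarrow> (\<forall>\<^sub>F N in sequentially. \<omega> \<in> E N))"
  shows "AE \<omega> in M. P \<omega>"
proof -
  have "\<exists>L. L \<in> events \<and> prob L \<le> \<kappa> \<and> (AE \<omega> in M. \<not> P \<omega> \<longrightarrow> \<omega> \<in> L)" if \<kappa>: "0 < \<kappa>" for \<kappa>
  proof -
    from small[OF \<kappa>] obtain E where E: "\<And>N. E N \<in> events" "\<And>N. prob (E N) \<le> \<kappa>"
      and ev: "AE \<omega> in M. \<not> P \<omega> \<longrightarrow> (\<forall>\<^sub>F N in sequentially. \<omega> \<in> E N)"
      by blast
    define L where "L = (\<Union>n. \<Inter>N\<in>{n..}. E N)"
    have inner: "(\<Inter>N\<in>{n..}. E N) \<in> events" for n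
      using E by (intro sets.countable_INT') auto
    have "(\<lambda>n. prob (\<Inter>N\<in>{n..}. E N)) \<longlonglongrightarrow> prob L"
      unfolding L_def using inner by (intro finite_Lim_measure_incseq) (auto simp: incseq_def)
    moreover have "prob (\<Inter>N\<in>{n..}. E N) \<le> \<kappa>" for n
      using finite_measure_mono[OF _ E(1)[of n], of "\<Inter>N\<in>{n..}. E N"] E(2)[of n] by force
    ultimately have "prob L \<le> \<kappa>" by (intro LIMSEQ_le_const2) auto
    moreover have "L \<in> events"
      unfolding L_def using inner by blast
    moreover have "AE \<omega> in M. \<not> P \<omega> \<longrightarrow> \<omega> \<in> L"
      using ev by eventually_elim (auto simp: L_def eventually_sequentially)
    ultimately show ?thesis by blast
  qed
  then have "\<forall>k. \<exists>L. L \<in> events \<and> prob L \<le> inverse (real (Suc k)) \<and> (AE \<omega> in M. \<not> P \<omega> \<longrightarrow> \<omega> \<in> L)"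
    by simp
  from choice[OF this] obtain L where L: "\<And>k. L k \<in> events" "\<And>k. prob (L k) \<le> inverse (real (Suc k))"
    and in_L: "\<And>k. AE \<omega> in M. \<not> P \<omega> \<longrightarrow> \<omega> \<in> L k"
    by blast
  have LI: "(\<Inter>k. L k) \<in> events" using L by blast
  have "prob (\<Inter>k. L k) \<le> prob (L k)" for k
    using L by (intro finite_measure_mono) auto
  then have "prob (\<Inter>k. L k) \<le> inverse (real (Suc k))" for k
    using L(2) order_trans by blast
  then have "prob (\<Inter>k. L k) \<le> 0"
    by (intro LIMSEQ_le_const[OF LIMSEQ_inverse_real_of_nat]) auto
  then have "prob (\<Inter>k. L k) = 0"
    by (simp add: measure_le_0_iff)
  then have "AE \<omega> in M. \<omega> \<notin> (\<Inter>k. L k)"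
    using prob_eq_0[OF LI] by simp
  moreover have "AE \<omega> in M. \<forall>k. \<not> P \<omega> \<longrightarrow> \<omega> \<in> L k"
    using in_L unfolding AE_all_countable by blast
  ultimately show ?thesis
    by eventually_elim blast
qed

text \<open>
  Conditionally on \<open>Z\<close>, the event is that \<open>V\<close> lies in an interval of length \<open>2 * e\<close>, and the density of \<open>V\<close> is
  at most \<open>1 / sqrt (2 * pi * \<sigma>\<^sup>2)\<close>.
\<close>

lemma (in prob_space) prob_normal_near_indep_le:
  fixes V Z :: "'a \<Rightarrow> real"
  assumes \<sigma>: "0 < \<sigma>" and V: "distributed M lborel V (normal_density 0 \<sigma>)"
    and indep: "indep_var borel V borel Z" and e: "0 < e"
  shows "prob {\<omega> \<in> space M. \<bar>V \<omega> - Z \<omega>\<bar> < e} \<le> 2 * e / sqrt (2 * pi * \<sigma>\<^sup>2)"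
proof -
  let ?K = "1 / sqrt (2 * pi * \<sigma>\<^sup>2)"
  let ?A = "{(v, z). \<bar>v - z\<bar> < e} :: (real \<times> real) set"
  have rv[measurable]: "random_variable borel V" "random_variable borel Z"
    and joint: "distr M borel V \<Otimes>\<^sub>M distr M borel Z = distr M (borel \<Otimes>\<^sub>M borel) (\<lambda>x. (V x, Z x))"
    using indep by (auto simp: indep_var_distribution_eq)
  interpret V: prob_space "distr M borel V" by (rule prob_space_distr) simp
  interpret Z: prob_space "distr M borel Z" by (rule prob_space_distr) simp
  interpret pair_sigma_finite "distr M borel V" "distr M borel Z" ..
  have A[measurable]: "?A \<in> sets (borel \<Otimes>\<^sub>M borel)"
  proof -
    have "Measurable.pred (borel \<Otimes>\<^sub>M borel) (\<lambda>x :: real \<times> real. \<bar>fst x - snd x\<bar> < e)" by measurable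
    moreover have "?A = {x. \<bar>fst x - snd x\<bar> < e}" by auto
    ultimately show ?thesis by (simp add: pred_def space_pair_measure)
  qed
  have dens: "normal_density 0 \<sigma> x \<le> ?K" for x
  proof -
    have "exp (- (x - 0)\<^sup>2 / (2 * \<sigma>\<^sup>2)) \<le> 1" by simp
    then have "1 / sqrt (2 * pi * \<sigma>\<^sup>2) * exp (- (x - 0)\<^sup>2 / (2 * \<sigma>\<^sup>2)) \<le> 1 / sqrt (2 * pi * \<sigma>\<^sup>2) * 1"
      by (intro mult_left_mono) auto
    then show ?thesis by (simp add: normal_density_def)
  qed
  have slice: "emeasure (distr M borel V) {v. \<bar>v - z\<bar> < e} \<le> ennreal (2 * e * ?K)" for z
  proof -
    have S: "{v. \<bar>v - z\<bar> < e} = {z - e <..< z + e}" by auto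
    have "distr M borel V = distr M lborel V" by (rule distr_cong) auto
    also have "\<dots> = density lborel (\<lambda>x. ennreal (normal_density 0 \<sigma> x))"
      using V by (rule distributed_distr_eq_density)
    finally have "emeasure (distr M borel V) {z - e <..< z + e} =
        (\<integral>\<^sup>+x. ennreal (normal_density 0 \<sigma> x) * indicator {z - e <..< z + e} x \<partial>lborel)"
      by (simp add: emeasure_density)
    also have "\<dots> \<le> (\<integral>\<^sup>+x. ennreal ?K * indicator {z - e <..< z + e} x \<partial>lborel)"
      using dens by (intro nn_integral_mono mult_right_mono ennreal_leI) auto
    also have "\<dots> = ennreal ?K * ennreal (2 * e)"
      using e by (simp add: nn_integral_cmult_indicator)
    also have "\<dots> = ennreal (2 * e * ?K)"
      using e by (simp add: ennreal_mult'[symmetric] mult.commute)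
    finally show ?thesis by (simp add: S)
  qed
  have "emeasure M {\<omega> \<in> space M. \<bar>V \<omega> - Z \<omega>\<bar> < e} = emeasure (distr M borel V \<Otimes>\<^sub>M distr M borel Z) ?A"
    unfolding joint by (subst emeasure_distr) (auto intro!: arg_cong[where f="emeasure M"])
  also have "\<dots> = (\<integral>\<^sup>+z. emeasure (distr M borel V) ((\<lambda>v. (v, z)) -` ?A) \<partial>distr M borel Z)"
    by (rule emeasure_pair_measure_alt2) simp
  also have "\<dots> \<le> (\<integral>\<^sup>+z. ennreal (2 * e * ?K) \<partial>distr M borel Z)"
    using slice by (intro nn_integral_mono) simp
  also have "\<dots> = ennreal (2 * e * ?K)"
    using Z.emeasure_space_1 by simp
  finally show ?thesis
    using e by (simp add: emeasure_eq_measure)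
qed

text \<open>
  A normal variable has no atoms, so it differs from every random variable independent of it. The bound on
  the probability of being within \<open>e\<close> is uniform in \<open>N\<close>, which extends this to limits of such variables.
\<close>

lemma (in prob_space) AE_normal_not_limit_of_indep:
  fixes V :: "'a \<Rightarrow> real"
  assumes \<sigma>: "0 < \<sigma>" and V: "distributed M lborel V (normal_density 0 \<sigma>)"
    and indep: "\<And>N. indep_var borel V borel (Z N)"
  shows "AE \<omega> in M. \<not> (\<lambda>N. Z N \<omega>) \<longlonglongrightarrow> V \<omega>"
proof -
  let ?c = "sqrt (2 * pi * \<sigma>\<^sup>2)"
  have c: "0 < ?c" using \<sigma> by simp
  have [measurable]: "random_variable borel V" "random_variable borel (Z N)" for N
    using indep[of N] by (auto simp: indep_var_distribution_eq)
  show ?thesis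
  proof (rule AE_if_eventually_in_small_events)
    fix \<kappa> :: real assume \<kappa>: "0 < \<kappa>"
    \<comment> \<open>The radius at which the density bound equals \<open>\<kappa>\<close>.\<close>
    define e where "e = \<kappa> * ?c / 2"
    have e: "0 < e" using c \<kappa> by (simp add: e_def)
    let ?E = "\<lambda>N. {\<omega> \<in> space M. \<bar>V \<omega> - Z N \<omega>\<bar> < e}"
    have "2 * e / ?c = \<kappa>" unfolding e_def using \<sigma> by simp
    then have "prob (?E N) \<le> \<kappa>" for N
      using prob_normal_near_indep_le[OF \<sigma> V indep e, of N] by simp
    moreover have "?E N \<in> events" for N by measurable
    moreover have "AE \<omega> in M. \<not> \<not> (\<lambda>N. Z N \<omega>) \<longlonglongrightarrow> V \<omega> \<longrightarrow> (\<forall>\<^sub>F N in sequentially. \<omega> \<in> ?E N)"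
    proof (rule AE_I2, rule impI)
      fix \<omega> assume "\<omega> \<in> space M" "\<not> \<not> (\<lambda>N. Z N \<omega>) \<longlonglongrightarrow> V \<omega>"
      then show "\<forall>\<^sub>F N in sequentially. \<omega> \<in> ?E N"
        using tendstoD[of "\<lambda>N. Z N \<omega>" "V \<omega>" sequentially e] e
        by (auto elim!: eventually_mono simp: dist_real_def abs_minus_commute)
    qed
    ultimately show "\<exists>E. (\<forall>N. E N \<in> events \<and> prob (E N) \<le> \<kappa>) \<and>
        (AE \<omega> in M. \<not> \<not> (\<lambda>N. Z N \<omega>) \<longlonglongrightarrow> V \<omega> \<longrightarrow> (\<forall>\<^sub>F N in sequentially. \<omega> \<in> E N))"
      by (intro exI[of _ ?E]) blast
  qed
qed

context standard_brownian_motion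
begin

lemma indep_increment_blocks:
  fixes t :: "nat \<Rightarrow> real"
  assumes t: "0 \<le> t 0" "\<And>i. i < n \<Longrightarrow> t i \<le> t (Suc i)"
    and AB: "A \<inter> B = {}" "A \<subseteq> {..<n}" "B \<subseteq> {..<n}"
    and f: "f \<in> borel_measurable (PiM A (\<lambda>_. borel :: real measure))"
    and g: "g \<in> borel_measurable (PiM B (\<lambda>_. borel :: real measure))"
  shows "indep_var borel (\<lambda>\<omega>. f (\<lambda>i\<in>A. W (t (Suc i)) \<omega> - W (t i) \<omega>) :: real)
                   borel (\<lambda>\<omega>. g (\<lambda>i\<in>B. W (t (Suc i)) \<omega> - W (t i) \<omega>) :: real)"
proof -
  have "indep_vars (\<lambda>_. borel) (\<lambda>i \<omega>. W (t (Suc i)) \<omega> - W (t i) \<omega>) {..<n}"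
    using t by (intro indep_increments) auto
  from indep_var_compose[OF indep_var_restrict[OF this AB] f g]
  show ?thesis by (simp add: o_def)
qed

text \<open>
  A grid on \<open>[0, p]\<close>, the single step from \<open>p\<close> to \<open>r\<close> and a grid on \<open>[r, q]\<close> together form one increasing
  sequence of times. The increment over the middle step is independent of all others, and \<open>F\<close> is applied to
  functions of these others.
\<close>

lemma AE_increment_not_limit:
  fixes F :: "real \<Rightarrow> real \<Rightarrow> real \<Rightarrow> real"
  assumes pq: "0 \<le> p" "p < r" "r \<le> q"
    and F: "(\<lambda>(x, y, z). F x y z) \<in> borel_measurable (borel \<Otimes>\<^sub>M borel \<Otimes>\<^sub>M borel)"
  shows "AE \<omega> in M. \<not> (\<lambda>N. F (grid_max (\<lambda>x. W x \<omega> - W 0 \<omega>) 0 p N) (W p \<omega> - W 0 \<omega>)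
      (grid_max (\<lambda>x. c * (W x \<omega> - W r \<omega>)) r q N)) \<longlonglongrightarrow> W r \<omega> - W p \<omega>"
proof (rule AE_normal_not_limit_of_indep[where \<sigma>="sqrt (r - p)"])
  show "0 < sqrt (r - p)" using pq by simp
  show "distributed M lborel (\<lambda>\<omega>. W r \<omega> - W p \<omega>) (normal_density 0 (sqrt (r - p)))"
    using pq by (intro normal_increments) auto
next
  fix N :: nat
  define K where "K = Suc N"
  have K: "0 < K" by (simp add: K_def)
  define t where "t i = (if i \<le> K then p * real i / real K
    else r + (q - r) * real (i - Suc K) / real K)" for i
  let ?n = "2 * K + 1"
  let ?B = "{..<?n} - {K}"
  let ?X = "\<lambda>\<omega> i. W (t (Suc i)) \<omega> - W (t i) \<omega>"
  \<comment> \<open>The functional of the increments that recovers the arguments of \<open>F\<close> by telescoping.\<close>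
  define h where "h x = F (Max ((\<lambda>i. \<Sum>l<i. x l) ` {..K})) (\<Sum>l<K. x l)
    (Max ((\<lambda>i. c * (\<Sum>l<i. x (Suc K + l))) ` {..K}))" for x :: "nat \<Rightarrow> real"
  have t0: "t 0 = 0" and tK: "t K = p" and tSK: "t (Suc K) = r"
    using K by (simp_all add: t_def)
  have mono: "t i \<le> t (Suc i)" if "i < ?n" for i
  proof -
    consider "i < K" | "i = K" | "K < i" by linarith
    then show ?thesis
    proof cases
      case 1 then show ?thesis using pq by (simp add: t_def divide_right_mono mult_left_mono)
    next
      case 2 then show ?thesis using pq tK tSK by simp
    next
      case 3 
      then have "(q - r) * real (i - Suc K) \<le> (q - r) * real (Suc i - Suc K)" 
        using pq by (intro mult_left_mono) auto
      then show ?thesis using 3 by (simp add: t_def divide_right_mono)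
    qed
  qed
  have h: "h \<in> borel_measurable (PiM ?B (\<lambda>_. borel))"
  proof -
    have "(\<lambda>x. (Max ((\<lambda>i. \<Sum>l<i. x l) ` {..K}), (\<Sum>l<K. x l),
        (Max ((\<lambda>i. c * (\<Sum>l<i. x (Suc K + l))) ` {..K})))) \<in> PiM ?B (\<lambda>_. borel :: real measure) \<rightarrow>\<^sub>M (borel \<Otimes>\<^sub>M borel \<Otimes>\<^sub>M borel)"
      by (intro measurable_Pair borel_measurable_Max borel_measurable_sum borel_measurable_times
        borel_measurable_const measurable_component_singleton) auto
    from measurable_compose[OF this F] show ?thesis by (simp add: h_def[abs_def])
  qed
  have "indep_var borel (\<lambda>\<omega>. (\<lambda>x. x K) (\<lambda>i\<in>{K}. ?X \<omega> i)) borel (\<lambda>\<omega>. h (\<lambda>i\<in>?B. ?X \<omega> i))"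
    by (rule indep_increment_blocks[where n="?n"]) (use t0 mono h in \<open>auto intro!: measurable_component_singleton\<close>)
  moreover have "(\<lambda>x. x K) (\<lambda>i\<in>{K}. ?X \<omega> i) = W r \<omega> - W p \<omega>" for \<omega>
    by (simp add: tK tSK)
  moreover have "h (\<lambda>i\<in>?B. ?X \<omega> i) = F (grid_max (\<lambda>x. W x \<omega> - W 0 \<omega>) 0 p N) (W p \<omega> - W 0 \<omega>)
      (grid_max (\<lambda>x. c * (W x \<omega> - W r \<omega>)) r q N)" for \<omega>
  proof -
    have 1: "(\<Sum>l<i. (\<lambda>i\<in>?B. ?X \<omega> i) l) = W (t i) \<omega> - W 0 \<omega>" if "i \<le> K" for i
    proof -
      have "(\<Sum>l<i. (\<lambda>i\<in>?B. ?X \<omega> i) l) = (\<Sum>l<i. ?X \<omega> l)" using that by (intro sum.cong) auto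
      also have "\<dots> = W (t i) \<omega> - W (t 0) \<omega>" by (rule sum_lessThan_telescope)
      finally show ?thesis by (simp add: t0)
    qed
    have 2: "(\<Sum>l<i. (\<lambda>i\<in>?B. ?X \<omega> i) (Suc K + l)) = W (t (Suc K + i)) \<omega> - W r \<omega>" if "i \<le> K" for i
    proof -
      have "(\<Sum>l<i. (\<lambda>i\<in>?B. ?X \<omega> i) (Suc K + l)) = (\<Sum>l<i. W (t (Suc K + Suc l)) \<omega> - W (t (Suc K + l)) \<omega>)"
        using that by (intro sum.cong) auto
      also have "\<dots> = W (t (Suc K + i)) \<omega> - W (t (Suc K + 0)) \<omega>"
        by (rule sum_lessThan_telescope)
      finally show ?thesis by (simp add: tSK)
    qed
    have "(\<lambda>i. \<Sum>l<i. (\<lambda>i\<in>?B. ?X \<omega> i) l) ` {..K} = (\<lambda>i. W (0 + (p - 0) * real i / real K) \<omega> - W 0 \<omega>) ` {..K}"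
      by (intro image_cong refl) (subst 1, auto simp: t_def)
    moreover have "(\<lambda>i. c * (\<Sum>l<i. (\<lambda>i\<in>?B. ?X \<omega> i) (Suc K + l))) ` {..K}
        = (\<lambda>i. c * (W (r + (q - r) * real i / real K) \<omega> - W r \<omega>)) ` {..K}"
      by (intro image_cong refl) (subst 2, auto simp: t_def)
    ultimately show ?thesis
      unfolding h_def grid_max_def K_def[symmetric] by (simp only: 1[OF order_refl] tK)
  qed
  ultimately show "indep_var borel (\<lambda>\<omega>. W r \<omega> - W p \<omega>) borel (\<lambda>\<omega>. F (grid_max (\<lambda>x. W x \<omega> - W 0 \<omega>) 0 p N)
      (W p \<omega> - W 0 \<omega>) (grid_max (\<lambda>x. c * (W x \<omega> - W r \<omega>)) r q N))"
    by simp
qed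

end

section \<open>Brownian motion leaves its present value on both sides\<close>

definition std_normal_measure :: "real measure" where
  "std_normal_measure = density lborel (\<lambda>x. ennreal (std_normal_density x))"

lemma std_normal_cdf_1_less: "measure std_normal_measure {..1} < 1"
proof -
  interpret N: prob_space std_normal_measure
    unfolding std_normal_measure_def by (rule prob_space_normal_density) simp
  have sets [simp]: "sets std_normal_measure = sets borel"
    by (simp add: std_normal_measure_def)
  have "N.prob {1<..2} \<noteq> 0"
  proof
    assume "N.prob {1<..2} = 0"
    then have "AE x in std_normal_measure. x \<notin> {1<..2::real}"
      by (subst (asm) N.prob_eq_0) auto
    then have "AE x in lborel. x \<notin> {1<..2::real}"
      unfolding std_normal_measure_def by (subst (asm) AE_density) (auto simp: normal_density_pos)
    then have "emeasure lborel {1<..2::real} = 0"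
      by (subst (asm) AE_iff_measurable[of "{1<..2}"]) auto
    then show False by simp
  qed
  then have "0 < N.prob {1<..2}" using measure_nonneg[of std_normal_measure "{1<..2}"] by linarith
  moreover have "N.prob ({..1} \<union> {1<..2}) = N.prob {..1} + N.prob {1<..2}"
    by (rule N.finite_measure_Union) auto
  moreover have "N.prob ({..1} \<union> {1<..2}) \<le> 1" by simp
  ultimately show ?thesis by linarith
qed

lemma (in prob_space) prob_centered_normal_le:
  assumes s: "0 < s" and Y: "distributed M lborel Y (normal_density 0 s)"
    and c: "c = 1 \<or> c = -1" and a: "a \<le> s"
  shows "prob {\<omega> \<in> space M. c * Y \<omega> \<le> a} \<le> measure std_normal_measure {..1}"
proof -
  have [measurable]: "random_variable borel Y" using Y by (auto simp: distributed_def)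
  have "distributed M lborel (\<lambda>\<omega>. 0 + c / s * Y \<omega>) (normal_density (0 + c / s * 0) (\<bar>c / s\<bar> * s))"
    using s c by (intro normal_density_affine[OF Y]) auto
  then have "distributed M lborel (\<lambda>\<omega>. c / s * Y \<omega>) std_normal_density"
    using s c by auto
  then have eq: "distr M lborel (\<lambda>\<omega>. c / s * Y \<omega>) = std_normal_measure"
    unfolding std_normal_measure_def by (rule distributed_distr_eq_density)
  have "prob {\<omega> \<in> space M. c * Y \<omega> \<le> a} \<le> prob ((\<lambda>\<omega>. c / s * Y \<omega>) -` {..1} \<inter> space M)"
    using s a by (intro finite_measure_mono) (auto simp: field_simps)
  also have "\<dots> = measure std_normal_measure {..1}"
    unfolding eq[symmetric] by (subst measure_distr) auto
  finally show ?thesis .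
qed

lemma (in prob_space) prob_centered_normal_large_le:
  assumes s: "0 < s" and Y: "distributed M lborel Y (normal_density 0 s)" and a: "0 < a"
  shows "prob {\<omega> \<in> space M. a \<le> \<bar>Y \<omega>\<bar>} \<le> s\<^sup>2 / a\<^sup>2"
proof -
  have [measurable]: "random_variable borel Y" using Y by (auto simp: distributed_def)
  have "integrable lborel (\<lambda>x. normal_density 0 s x * x\<^sup>2)"
    using integrable_normal_moment[OF s, of 0 2] by simp
  then have "integrable M (\<lambda>\<omega>. (Y \<omega>)\<^sup>2)"
    by (subst (asm) distributed_integrable[OF Y]) auto
  from Chebyshev_inequality[OF _ this a] show ?thesis
    using normal_distributed_expectation[OF s Y] normal_distributed_variance[OF s Y] by simp
qed

context standard_brownian_motion
begin

text \<open>
  Times \<open>t j\<close> increasing geometrically with a very large ratio make the increments dominate: the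
  increment from \<open>t j\<close> to \<open>t (Suc j)\<close> has standard deviation comparable to \<open>sqrt (t (Suc j))\<close>, while by
  Chebyshev the position at time \<open>t j\<close> is much smaller with high probability. If the path stays below
  \<open>e\<close> at all these times, each of the \<open>m\<close> independent increments is at most one standard deviation, which has
  probability at most \<open>\<theta> ^ m\<close>, where \<open>\<theta> < 1\<close> is that probability for one of them. The number \<open>m\<close> is chosen to make this small, and then the ratio
  \<open>1 / \<rho>\<close> so large that the Chebyshev errors add up to little. The times do not depend on the starting time \<open>p\<close>.
\<close>

lemma small_ball:
  assumes \<eta>: "0 < \<eta>" and \<kappa>: "0 < \<kappa>"
  shows "\<exists>e>0. \<exists>m t. (\<forall>j<m. t j \<le> t (Suc j)) \<and> (\<forall>j\<le>m. 0 < t j \<and> t j \<le> \<eta>) \<and>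
    (\<forall>p\<ge>0. \<forall>c\<in>{1, -1}.
      prob {\<omega> \<in> space M. \<forall>j\<le>m. c * (W (p + t j) \<omega> - W p \<omega>) \<le> e} \<le> \<kappa>)"
proof -
  define \<theta> where "\<theta> = measure std_normal_measure {..1}"
  have \<theta>: "0 \<le> \<theta>" "\<theta> < 1" using std_normal_cdf_1_less by (auto simp: \<theta>_def)
  have "(\<lambda>m. \<theta> ^ m) \<longlonglongrightarrow> 0" using \<theta> by (intro LIMSEQ_power_zero) auto
  then have "\<forall>\<^sub>F m in sequentially. \<theta> ^ m < \<kappa> / 2" using \<kappa> by (intro order_tendstoD) auto
  moreover have "\<forall>\<^sub>F m in sequentially. 0 < m" by (rule eventually_gt_at_top)
  ultimately have "\<forall>\<^sub>F m in sequentially. \<theta> ^ m < \<kappa> / 2 \<and> 0 < m" by eventually_elim auto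
  then obtain m where m: "\<theta> ^ m < \<kappa> / 2" "0 < m" by (auto simp: eventually_sequentially)
  define \<rho> where "\<rho> = min (3/4) (\<kappa> / (32 * real m))"
  have \<rho>: "0 < \<rho>" "\<rho> \<le> 3/4" "16 * real m * \<rho> \<le> \<kappa> / 2"
    using \<kappa> m by (auto simp: \<rho>_def min_def field_simps)
  define t where "t j = \<eta> * \<rho> ^ (m - j)" for j
  have tpos: "0 < t j" for j using \<eta> \<rho> by (simp add: t_def)
  have tle: "t j \<le> \<eta>" for j using \<eta> \<rho> by (simp add: t_def power_le_one mult_left_le)
  have tSuc: "t j = \<rho> * t (Suc j)" if "j < m" for j
  proof -
    have "m - j = Suc (m - Suc j)" using that by simp
    then show ?thesis by (simp add: t_def)
  qed
  have tmono1: "t j \<le> t (Suc j)" if "j < m" for j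
    using tSuc[OF that] \<rho> tpos[of "Suc j"] by (simp add: mult_le_cancel_right1)
  have t0: "t 0 \<le> t (Suc j)" if "j < m" for j
    using that
  proof (induction j)
    case 0 then show ?case using tmono1[of 0] by simp
  next
    case (Suc j) then show ?case using tmono1[of "Suc j"] by simp
  qed
  \<comment> \<open>Small against the standard deviation of every increment, since \<open>t 0\<close> is the least of the times.\<close>
  define e where "e = sqrt (t 0) / 4"
  have bound: "prob {\<omega> \<in> space M. \<forall>j\<le>m. c * (W (p + t j) \<omega> - W p \<omega>) \<le> e} \<le> \<kappa>"
    if p: "0 \<le> p" and c: "c = 1 \<or> c = -1" for p c
  proof -
    let ?Y = "\<lambda>j \<omega>. W (p + t (Suc j)) \<omega> - W (p + t j) \<omega>"
    let ?G = "\<Inter>j\<in>{..<m}. ?Y j -` {y. c * y \<le> sqrt (t (Suc j)) / 2} \<inter> space M"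
    let ?B = "\<lambda>j. {\<omega> \<in> space M. sqrt (t (Suc j)) / 4 \<le> \<bar>W (p + t j) \<omega> - W p \<omega>\<bar>}"
    have [measurable]: "random_variable borel (W p)" "random_variable borel (W (p + t j))" for j
      using p tpos[of j] by (auto intro!: measurable_W)
    have G: "?G \<in> events"
      using m by (intro sets.finite_INT) auto
    have sub: "{\<omega> \<in> space M. \<forall>j\<le>m. c * (W (p + t j) \<omega> - W p \<omega>) \<le> e} \<subseteq> ?G \<union> (\<Union>j<m. ?B j)"
    proof
      fix \<omega> assume \<omega>: "\<omega> \<in> {\<omega> \<in> space M. \<forall>j\<le>m. c * (W (p + t j) \<omega> - W p \<omega>) \<le> e}"
      show "\<omega> \<in> ?G \<union> (\<Union>j<m. ?B j)"
      proof (cases "\<omega> \<in> (\<Union>j<m. ?B j)")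
        case False
        have "c * ?Y j \<omega> \<le> sqrt (t (Suc j)) / 2" if j: "j < m" for j
        proof -
          have "c * (W (p + t (Suc j)) \<omega> - W p \<omega>) \<le> e" using \<omega> j by auto
          moreover have "e \<le> sqrt (t (Suc j)) / 4" using t0[OF j] by (simp add: e_def)
          moreover have "\<bar>W (p + t j) \<omega> - W p \<omega>\<bar> < sqrt (t (Suc j)) / 4"
            using False \<omega> j by force
          then have "W (p + t j) \<omega> - W p \<omega> < sqrt (t (Suc j)) / 4"
            "- (sqrt (t (Suc j)) / 4) < W (p + t j) \<omega> - W p \<omega>" by linarith+
          ultimately show ?thesis using c by auto
        qed
        then show ?thesis using \<omega> by auto
      qed simp
    qed
    have "prob ?G = (\<Prod>j<m. prob (?Y j -` {y. c * y \<le> sqrt (t (Suc j)) / 2} \<inter> space M))"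
    proof (rule indep_varsD_finite[where M'="\<lambda>_. borel"])
      show "indep_vars (\<lambda>_. borel) ?Y {..<m}"
        using p tpos[of 0] tmono1 by (intro indep_increments[of "\<lambda>j. p + t j"]) auto
    qed (use m in auto)
    also have "\<dots> \<le> (\<Prod>j<m. \<theta>)"
    proof (intro prod_mono conjI measure_nonneg)
      fix j assume "j \<in> {..<m}"
      then have j: "j < m" by simp
      have diff: "(p + t (Suc j)) - (p + t j) = (1 - \<rho>) * t (Suc j)"
        using tSuc[OF j] by (simp add: algebra_simps)
      \<comment> \<open>From \<open>\<rho> \<le> 3/4\<close>: the threshold \<open>sqrt (t (Suc j)) / 2\<close> is at most one standard deviation.\<close>
      have quarter: "t (Suc j) / 4 \<le> (p + t (Suc j)) - (p + t j)"
        unfolding diff using \<rho>(2) tpos[of "Suc j"] mult_right_mono[of "1/4" "1 - \<rho>" "t (Suc j)"] by simp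
      have pos: "0 < (p + t (Suc j)) - (p + t j)"
        using quarter tpos[of "Suc j"] by linarith
      have "sqrt (t (Suc j)) / 2 = sqrt (t (Suc j) / 4)" by (simp add: real_sqrt_divide)
      also have "\<dots> \<le> sqrt ((p + t (Suc j)) - (p + t j))" using quarter by simp
      finally have "prob {\<omega> \<in> space M. c * ?Y j \<omega> \<le> sqrt (t (Suc j)) / 2} \<le> \<theta>"
        unfolding \<theta>_def using p tpos[of j] pos c
        by (intro prob_centered_normal_le[OF _ normal_increments]) auto
      moreover have "?Y j -` {y. c * y \<le> sqrt (t (Suc j)) / 2} \<inter> space M
         = {\<omega> \<in> space M. c * ?Y j \<omega> \<le> sqrt (t (Suc j)) / 2}" by auto
      ultimately show "prob (?Y j -` {y. c * y \<le> sqrt (t (Suc j)) / 2} \<inter> space M) \<le> \<theta>" by simp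
    qed
    also have "\<dots> = \<theta> ^ m" by simp
    finally have PG: "prob ?G \<le> \<kappa> / 2" using m by simp
    have PB: "prob (?B j) \<le> 16 * \<rho>" if j: "j < m" for j
    proof -
      have "distributed M lborel (\<lambda>\<omega>. W (p + t j) \<omega> - W p \<omega>) (normal_density 0 (sqrt ((p + t j) - p)))"
        using p tpos[of j] by (intro normal_increments) auto
      then have "prob (?B j) \<le> (sqrt (t j))\<^sup>2 / (sqrt (t (Suc j)) / 4)\<^sup>2"
        using tpos by (intro prob_centered_normal_large_le) auto
      also have "\<dots> = 16 * \<rho>"
        using tSuc[OF j] tpos[of j] tpos[of "Suc j"] by (simp add: power_divide field_simps)
      finally show ?thesis .
    qed
    have "prob {\<omega> \<in> space M. \<forall>j\<le>m. c * (W (p + t j) \<omega> - W p \<omega>) \<le> e} \<le> prob (?G \<union> (\<Union>j<m. ?B j))"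
      using G by (intro finite_measure_mono sub sets.Un sets.finite_UN) auto
    also have "\<dots> \<le> prob ?G + prob (\<Union>j<m. ?B j)"
      using G by (intro measure_Un_le sets.finite_UN) auto
    also have "prob (\<Union>j<m. ?B j) \<le> (\<Sum>j<m. prob (?B j))"
      by (intro finite_measure_subadditive_finite) auto
    also have "\<dots> \<le> (\<Sum>j<m. 16 * \<rho>)" using PB by (intro sum_mono) auto
    also have "\<dots> \<le> \<kappa> / 2" using \<rho>(3) by (simp add: mult_ac)
    finally show ?thesis using PG by simp
  qed
  moreover have "0 < e" using tpos[of 0] by (simp add: e_def)
  ultimately show ?thesis
    using tmono1 tpos tle
    by (intro exI[of _ e] conjI exI[of _ m] exI[of _ t] allI impI ballI bound) auto
qed

lemma AE_positive_immediately:
  "AE \<omega> in M. \<forall>d>0. \<exists>x. 0 < x \<and> x \<le> d \<and> W 0 \<omega> < W x \<omega>"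
proof -
  have "AE \<omega> in M. \<exists>x. 0 < x \<and> x \<le> 1 / real (Suc i) \<and> W 0 \<omega> < W x \<omega>" for i
  proof (rule AE_if_eventually_in_small_events)
    fix \<kappa> :: real assume \<kappa>: "0 < \<kappa>"
    have "0 < 1 / real (Suc i)" by simp
    from small_ball[OF this \<kappa>]
    obtain e m t where t: "0 < e" "\<forall>j<m. t j \<le> t (Suc j)"
        "\<forall>j\<le>m. 0 < t j \<and> t j \<le> 1 / real (Suc i)"
      and small: "\<forall>p\<ge>0. \<forall>c\<in>{1, -1}.
        prob {\<omega> \<in> space M. \<forall>j\<le>m. c * (W (p + t j) \<omega> - W p \<omega>) \<le> e} \<le> \<kappa>"
    by blast
    let ?E = "{\<omega> \<in> space M. \<forall>j\<in>{..m}. 1 * (W (0 + t j) \<omega> - W 0 \<omega>) \<le> e}"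
    have "?E \<in> events"
    proof (rule sets.sets_Collect_finite_All)
      fix j assume "j \<in> {..m}"
      then have [measurable]: "random_variable borel (W 0)" "random_variable borel (W (0 + t j))"
        using t(3) by (auto intro!: measurable_W simp: less_imp_le)
      show "{\<omega> \<in> space M. 1 * (W (0 + t j) \<omega> - W 0 \<omega>) \<le> e} \<in> events" by measurable
    qed simp
    moreover have "prob ?E \<le> \<kappa>"
      using small[rule_format, of 0 1] by (simp add: Ball_def)
    moreover have "AE \<omega> in M. \<not> (\<exists>x. 0 < x \<and> x \<le> 1 / real (Suc i) \<and> W 0 \<omega> < W x \<omega>) \<longrightarrow> \<omega> \<in> ?E"
    proof (rule AE_I2, rule impI)
      fix \<omega> assume \<omega>: "\<omega> \<in> space M" "\<not> (\<exists>x. 0 < x \<and> x \<le> 1 / real (Suc i) \<and> W 0 \<omega> < W x \<omega>)"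
      have "W (t j) \<omega> - W 0 \<omega> \<le> e" if "j \<le> m" for j
      proof -
        have "0 < t j" "t j \<le> 1 / real (Suc i)" using t(3) that by auto
        then have "W (t j) \<omega> \<le> W 0 \<omega>" using \<omega> not_le by blast
        then show ?thesis using t(1) by simp
      qed
      then show "\<omega> \<in> ?E" using \<omega> by simp
    qed
    ultimately show "\<exists>E. (\<forall>N. E N \<in> events \<and> prob (E N) \<le> \<kappa>) \<and> (AE \<omega> in M.
        \<not> (\<exists>x. 0 < x \<and> x \<le> 1 / real (Suc i) \<and> W 0 \<omega> < W x \<omega>) \<longrightarrow> (\<forall>\<^sub>F N in sequentially. \<omega> \<in> E N))"
      by (intro exI[of _ "\<lambda>N. ?E"]) simp
  qed
  then have "AE \<omega> in M. \<forall>i. \<exists>x. 0 < x \<and> x \<le> 1 / real (Suc i) \<and> W 0 \<omega> < W x \<omega>"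
    by (simp add: AE_all_countable)
  then show ?thesis
  proof eventually_elim
    case (elim \<omega>)
    show ?case
    proof (intro allI impI)
      fix d :: real assume "0 < d"
      then obtain i where "1 / real (Suc i) < d" using nat_approx_posE by blast
      then show "\<exists>x. 0 < x \<and> x \<le> d \<and> W 0 \<omega> < W x \<omega>" using elim by (meson less_imp_le order_trans)
    qed
  qed
qed

lemma AE_continuous_path:
  "AE \<omega> in M. continuous_path (\<lambda>t. W t \<omega>)"
  using continuous_paths by eventually_elim (simp add: continuous_path_def)

text \<open>
  For \<open>s > 0\<close> the maximum is attained at a positive time, hence after some rational \<open>r > 0\<close>. Then
  \<open>W r - W 0\<close> equals \<open>s\<close> minus the maximum of \<open>W x - W r\<close> over later \<open>x\<close>, which is independent of it.
  For \<open>s = 0\<close> the maximum may be attained at time 0, and the small ball estimate takes over.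
\<close>

lemma AE_path_max_neq:
  assumes "0 < q" "0 \<le> s"
  shows "AE \<omega> in M. path_max (\<lambda>t. W t \<omega>) q \<noteq> s"
proof (cases "s = 0")
  case True
  show ?thesis using AE_continuous_path AE_positive_immediately W_zero
  proof eventually_elim
    case (elim \<omega>)
    interpret continuous_path "\<lambda>t. W t \<omega>" by fact
    obtain x where "0 < x" "x \<le> q" "0 < W x \<omega>" using elim assms by auto
    then show ?case using path_max_ge[of x q] True by simp
  qed
next
  case False
  have "AE \<omega> in M. \<forall>r\<in>\<rat> \<inter> {0<..<q}. \<not> (\<lambda>N. s - grid_max (\<lambda>x. 1 * (W x \<omega> - W r \<omega>)) r q N) \<longlonglongrightarrow> W r \<omega> - W 0 \<omega>"
  proof (subst AE_ball_countable)
    show "countable (\<rat> \<inter> {0<..<q})" using countable_rat by blast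
    show "\<forall>r\<in>\<rat> \<inter> {0<..<q}. AE \<omega> in M. \<not> (\<lambda>N. s - grid_max (\<lambda>x. 1 * (W x \<omega> - W r \<omega>)) r q N) \<longlonglongrightarrow> W r \<omega> - W 0 \<omega>"
    proof
      fix r assume "r \<in> \<rat> \<inter> {0<..<q}"
      then show "AE \<omega> in M. \<not> (\<lambda>N. s - grid_max (\<lambda>x. 1 * (W x \<omega> - W r \<omega>)) r q N) \<longlonglongrightarrow> W r \<omega> - W 0 \<omega>"
        by (intro AE_increment_not_limit[of 0 r q "\<lambda>x y z. s - z"]) auto
    qed
  qed
  with AE_continuous_path W_zero show ?thesis
  proof eventually_elim
    case (elim \<omega>)
    interpret continuous_path "\<lambda>t. W t \<omega>" by fact
    show ?case
    proof
      assume max: "path_max (\<lambda>t. W t \<omega>) q = s"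
      obtain u where u: "0 \<le> u" "u \<le> q" "W u \<omega> = s"
        using path_max_attained[of q] assms max by (metis less_imp_le)
      have "u \<noteq> 0" using u(3) elim(2) False by auto
      then have "0 < u" using u(1) by simp
      then obtain r where r: "r \<in> \<rat>" "0 < r" "r < u" using Rats_dense_in_real by blast
      have "(SUP x\<in>{r..q}. 1 * (W x \<omega> - W r \<omega>)) = s - W r \<omega>"
        using path_max_ge[of _ q] r u max by (intro cSup_eq_maximum) (auto intro!: image_eqI[of _ _ u])
      moreover have "continuous_on {r..q} (\<lambda>x. 1 * (W x \<omega> - W r \<omega>))"
        using r by (intro continuous_intros cont_on) auto
      then have "grid_max (\<lambda>x. 1 * (W x \<omega> - W r \<omega>)) r q \<longlonglongrightarrow> (SUP x\<in>{r..q}. 1 * (W x \<omega> - W r \<omega>))"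
        using r u by (intro grid_max_tendsto_SUP) auto
      ultimately have "grid_max (\<lambda>x. 1 * (W x \<omega> - W r \<omega>)) r q \<longlonglongrightarrow> s - W r \<omega>" by simp
      from tendsto_diff[OF tendsto_const[of s] this]
      have "(\<lambda>N. s - grid_max (\<lambda>x. 1 * (W x \<omega> - W r \<omega>)) r q N) \<longlonglongrightarrow> W r \<omega> - W 0 \<omega>"
        using elim(2) by simp
      then show False using elim(3) r u by auto
    qed
  qed
qed

end

section \<open>Behaviour after the first hit of a level\<close>

context standard_brownian_motion
begin

text \<open>
  The Markov property at the first grid time at which the path has reached \<open>a\<close>: the event that this
  time is \<open>k * \<delta>\<close> depends on the increments up to \<open>k * \<delta>\<close> only, and conditionally on it the path
  drops by at most \<open>e\<close> at all times \<open>t j\<close> with probability at most \<open>\<kappa>\<close>. These events are disjoint for different \<open>k\<close>, so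
  the conditional bound is also a bound for the union.
\<close>

lemma prob_stay_above_at_grid_hit:
  fixes a e \<delta> :: real and t :: "nat \<Rightarrow> real"
  assumes \<delta>: "0 < \<delta>" and t: "0 \<le> t 0" "\<And>j. j < m \<Longrightarrow> t j \<le> t (Suc j)"
    and small: "\<And>p. 0 \<le> p \<Longrightarrow> prob {\<omega> \<in> space M. \<forall>j\<le>m. -1 * (W (p + t j) \<omega> - W p \<omega>) \<le> e} \<le> \<kappa>"
  defines "E \<equiv> {\<omega> \<in> space M. \<exists>k. (\<forall>j<k. W (real j * \<delta>) \<omega> - W 0 \<omega> < a) \<and> a \<le> W (real k * \<delta>) \<omega> - W 0 \<omega> \<and>
      (\<forall>j\<le>m. -1 * (W (real k * \<delta> + t j) \<omega> - W (real k * \<delta>) \<omega>) \<le> e)}"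
  shows "E \<in> events" "prob E \<le> \<kappa>"
proof -
  let ?A = "\<lambda>k. {\<omega> \<in> space M. (\<forall>j<k. W (real j * \<delta>) \<omega> - W 0 \<omega> < a) \<and> a \<le> W (real k * \<delta>) \<omega> - W 0 \<omega>}"
  let ?B = "\<lambda>k. {\<omega> \<in> space M. \<forall>j\<le>m. -1 * (W (real k * \<delta> + t j) \<omega> - W (real k * \<delta>) \<omega>) \<le> e}"
  have tnn: "0 \<le> t j" if "j \<le> m" for j
    using that
  proof (induction j)
    case (Suc j) then show ?case using t(2)[of j] by simp
  qed (use t(1) in simp)
  have [measurable]: "random_variable borel (W (real j * \<delta>))" "random_variable borel (W 0)" for j
    using \<delta> by (auto intro!: measurable_W)
  have rv: "random_variable borel (W (real k * \<delta> + t j))" if "j \<le> m" for j k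
    using \<delta> tnn[OF that] by (auto intro!: measurable_W)
  have A: "?A k \<in> events" for k
  proof -
    have "{\<omega> \<in> space M. (\<forall>j\<in>{..<k}. W (real j * \<delta>) \<omega> - W 0 \<omega> < a) \<and> a \<le> W (real k * \<delta>) \<omega> - W 0 \<omega>} \<in> events"
      by (intro sets.sets_Collect_conj sets.sets_Collect_finite_All) measurable
    then show ?thesis by (simp only: Ball_def lessThan_iff)
  qed
  have B: "?B k \<in> events" for k
  proof -
    have "{\<omega> \<in> space M. \<forall>j\<in>{..m}. -1 * (W (real k * \<delta> + t j) \<omega> - W (real k * \<delta>) \<omega>) \<le> e} \<in> events"
    proof (rule sets.sets_Collect_finite_All)
      fix j assume "j \<in> {..m}"
      then have [measurable]: "random_variable borel (W (real k * \<delta> + t j))" by (auto intro: rv)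
      show "{\<omega> \<in> space M. -1 * (W (real k * \<delta> + t j) \<omega> - W (real k * \<delta>) \<omega>) \<le> e} \<in> events" by measurable
    qed simp
    then show ?thesis by (simp only: Ball_def atMost_iff)
  qed
  have E: "E = (\<Union>k. ?A k \<inter> ?B k)" unfolding E_def by blast
  show "E \<in> events" unfolding E by (intro sets.countable_nat_UN image_subsetI sets.Int A B)
  have indep: "prob (?A k \<inter> ?B k) = prob (?A k) * prob (?B k)" for k
  proof -
    \<comment> \<open>The grid up to \<open>k * \<delta>\<close>, followed by the times \<open>k * \<delta> + t j\<close>.\<close>
    define s where "s l = (if l \<le> k then real l * \<delta> else real k * \<delta> + t (l - Suc k))" for l
    let ?n = "k + Suc m"
    let ?X = "\<lambda>\<omega> i. W (s (Suc i)) \<omega> - W (s i) \<omega>"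
    let ?I = "{..<k}" and ?J = "{k..<k + Suc m}"
    define f where "f x = (if (\<forall>j<k. (\<Sum>l<j. x l) < a) \<and> a \<le> (\<Sum>l<k. x l) then 1 else 0 :: real)" for x :: "nat \<Rightarrow> real"
    define g where "g x = Max ((\<lambda>j. -1 * (\<Sum>l<Suc j. x (k + l))) ` {..m})" for x :: "nat \<Rightarrow> real"
    have s0: "0 \<le> s 0" by (simp add: s_def)
    have smono: "s i \<le> s (Suc i)" if "i < ?n" for i
    proof -
      consider "i < k" | "i = k" | "k < i" by linarith
      then show ?thesis
      proof cases
        case 1 then show ?thesis using \<delta> by (simp add: s_def)
      next
        case 2 then show ?thesis using tnn[of 0] by (simp add: s_def)
      next
        case 3 
        then have "Suc i - Suc k = Suc (i - Suc k)" "i - Suc k < m" using that by auto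
        then show ?thesis using 3 t(2)[of "i - Suc k"] by (simp add: s_def)
      qed
    qed
    have part: "(\<lambda>x. \<Sum>l<j. x l) \<in> borel_measurable (PiM ?I (\<lambda>_. borel :: real measure))" if "j \<le> k" for j
      using that by (intro borel_measurable_sum measurable_component_singleton) auto
    have fm: "f \<in> borel_measurable (PiM ?I (\<lambda>_. borel))"
    proof -
      have "{x \<in> space (PiM ?I (\<lambda>_. borel :: real measure)). (\<forall>j\<in>{..<k}. (\<Sum>l<j. x l) < a) \<and> a \<le> (\<Sum>l<k. x l)} \<in> sets (PiM ?I (\<lambda>_. borel))"
      proof (intro sets.sets_Collect_conj sets.sets_Collect_finite_All)
        fix j assume "j \<in> {..<k}"
        then have [measurable]: "(\<lambda>x. \<Sum>l<j. x l) \<in> borel_measurable (PiM ?I (\<lambda>_. borel :: real measure))"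
          by (intro part) simp
        show "{x \<in> space (PiM ?I (\<lambda>_. borel :: real measure)). (\<Sum>l<j. x l) < a} \<in> sets (PiM ?I (\<lambda>_. borel))"
          by measurable
      next
        have [measurable]: "(\<lambda>x. \<Sum>l<k. x l) \<in> borel_measurable (PiM ?I (\<lambda>_. borel :: real measure))"
          by (intro part) simp
        show "{x \<in> space (PiM ?I (\<lambda>_. borel :: real measure)). a \<le> (\<Sum>l<k. x l)} \<in> sets (PiM ?I (\<lambda>_. borel))"
          by measurable
      qed simp
      then show ?thesis
        unfolding f_def[abs_def] by (intro measurable_If) (simp_all add: Ball_def)
    qed
    have gm: "g \<in> borel_measurable (PiM ?J (\<lambda>_. borel))"
      unfolding g_def[abs_def]
      by (intro borel_measurable_Max borel_measurable_sum borel_measurable_times borel_measurable_const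
          measurable_component_singleton) auto
    have ind: "indep_var borel (\<lambda>\<omega>. f (\<lambda>i\<in>?I. ?X \<omega> i)) borel (\<lambda>\<omega>. g (\<lambda>i\<in>?J. ?X \<omega> i))"
      by (rule indep_increment_blocks[OF s0 smono _ _ _ fm gm]) auto
    have 1: "(\<Sum>l<j. (\<lambda>i\<in>?I. ?X \<omega> i) l) = W (real j * \<delta>) \<omega> - W 0 \<omega>" if "j \<le> k" for j \<omega>
    proof -
      have "(\<Sum>l<j. (\<lambda>i\<in>?I. ?X \<omega> i) l) = (\<Sum>l<j. ?X \<omega> l)" using that by (intro sum.cong) auto
      also have "\<dots> = W (s j) \<omega> - W (s 0) \<omega>" by (rule sum_lessThan_telescope)
      finally show ?thesis using that by (simp add: s_def)
    qed
    have 2: "(\<Sum>l<Suc j. (\<lambda>i\<in>?J. ?X \<omega> i) (k + l)) = W (real k * \<delta> + t j) \<omega> - W (real k * \<delta>) \<omega>" if "j \<le> m" for j \<omega>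
    proof -
      have "(\<Sum>l<Suc j. (\<lambda>i\<in>?J. ?X \<omega> i) (k + l)) = (\<Sum>l<Suc j. W (s (k + Suc l)) \<omega> - W (s (k + l)) \<omega>)"
        using that by (intro sum.cong) auto
      also have "\<dots> = W (s (k + Suc j)) \<omega> - W (s (k + 0)) \<omega>"
        by (rule sum_lessThan_telescope)
      finally show ?thesis by (simp add: s_def)
    qed
    have fA: "(\<lambda>\<omega>. f (\<lambda>i\<in>?I. ?X \<omega> i)) -` {1} \<inter> space M = ?A k"
    proof -
      have "f (\<lambda>i\<in>?I. ?X \<omega> i) = 1 \<longleftrightarrow> (\<forall>j<k. W (real j * \<delta>) \<omega> - W 0 \<omega> < a) \<and> a \<le> W (real k * \<delta>) \<omega> - W 0 \<omega>" for \<omega>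
        unfolding f_def using 1[of k] 1 by (auto simp del: restrict_apply)
      then show ?thesis by auto
    qed
    have gB: "(\<lambda>\<omega>. g (\<lambda>i\<in>?J. ?X \<omega> i)) -` {..e} \<inter> space M = ?B k"
    proof -
      have "g (\<lambda>i\<in>?J. ?X \<omega> i) \<le> e \<longleftrightarrow> (\<forall>j\<le>m. -1 * (W (real k * \<delta> + t j) \<omega> - W (real k * \<delta>) \<omega>) \<le> e)" for \<omega>
      proof -
        have "(\<lambda>j. -1 * (\<Sum>l<Suc j. (\<lambda>i\<in>?J. ?X \<omega> i) (k + l))) ` {..m} =
            (\<lambda>j. -1 * (W (real k * \<delta> + t j) \<omega> - W (real k * \<delta>) \<omega>)) ` {..m}"
          by (intro image_cong refl) (subst 2, auto)
        then have "g (\<lambda>i\<in>?J. ?X \<omega> i) = Max ((\<lambda>j. -1 * (W (real k * \<delta> + t j) \<omega> - W (real k * \<delta>) \<omega>)) ` {..m})"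
          unfolding g_def by (rule arg_cong)
        then show ?thesis by (simp only: Max_le_iff finite_imageI finite_atMost) auto
      qed
      then show ?thesis by auto
    qed
    have "(\<lambda>\<omega>. (f (\<lambda>i\<in>?I. ?X \<omega> i), g (\<lambda>i\<in>?J. ?X \<omega> i))) -` ({1} \<times> {..e}) \<inter> space M = ?A k \<inter> ?B k"
      unfolding fA[symmetric] gB[symmetric] by auto
    with indep_varD[OF ind, of "{1}" "{..e}"] show ?thesis
      unfolding fA gB by simp
  qed
  have disj_less: "?A k \<inter> ?A k' = {}" if "k < k'" for k k'
  proof (rule equals0I)
    fix \<omega> assume "\<omega> \<in> ?A k \<inter> ?A k'"
    then have "a \<le> W (real k * \<delta>) \<omega> - W 0 \<omega>" "W (real k * \<delta>) \<omega> - W 0 \<omega> < a"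
      using that by simp_all
    then show False by linarith
  qed
  have disj: "disjoint_family ?A"
    unfolding disjoint_family_on_def
  proof (intro ballI impI)
    fix k k' :: nat assume "k \<noteq> k'"
    then consider "k < k'" | "k' < k" by linarith
    then show "?A k \<inter> ?A k' = {}"
      by cases (use disj_less[of k k'] disj_less[of k' k] in \<open>simp_all only: Int_commute\<close>)
  qed
  have sumsE: "(\<lambda>k. prob (?A k \<inter> ?B k)) sums prob (\<Union>k. ?A k \<inter> ?B k)"
  proof (rule finite_measure_UNION)
    show "disjoint_family (\<lambda>k. ?A k \<inter> ?B k)"
      using disj by (rule disjoint_family_on_bisimulation) blast
  qed (intro image_subsetI sets.Int A B)
  have sumsA: "(\<lambda>k. prob (?A k)) sums prob (\<Union>k. ?A k)"
    by (rule finite_measure_UNION[OF _ disj]) (intro image_subsetI A)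
  have "0 \<le> \<kappa>" using small[of 0] measure_nonneg order_trans by blast
  have "prob (?A k \<inter> ?B k) \<le> \<kappa> * prob (?A k)" for k
    unfolding indep using mult_left_mono[OF small[of "real k * \<delta>"] measure_nonneg[of M "?A k"]] \<delta>
    by (simp add: mult.commute)
  then have "prob E \<le> \<kappa> * prob (\<Union>k. ?A k)"
    unfolding E using sums_le[OF _ sumsE sums_mult[OF sumsA]] by blast
  also have "\<dots> \<le> \<kappa> * 1" using \<open>0 \<le> \<kappa>\<close> by (intro mult_left_mono) auto
  finally show "prob E \<le> \<kappa>" by simp
qed

end

context continuous_path
begin

text \<open>
  The path is above \<open>a\<close> on an open time interval arbitrarily soon after \<open>h\<close>, and every fine enough grid has
  a point in it; before \<open>h\<close> no grid point can be a hit.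
\<close>

lemma first_grid_hit_near:
  assumes h: "0 \<le> h" "w h = a" "\<And>v. 0 \<le> v \<Longrightarrow> v < h \<Longrightarrow> w v < a"
    and exceeds: "\<And>x. h < x \<Longrightarrow> a < path_max w x" and r: "0 < r"
  shows "\<forall>\<^sub>F N in sequentially. \<exists>k. (\<forall>j<k. w (real j * (1 / real (Suc N))) < a) \<and>
    a \<le> w (real k * (1 / real (Suc N))) \<and> h \<le> real k * (1 / real (Suc N)) \<and> real k * (1 / real (Suc N)) < h + r"
proof -
  have "0 \<le> h + r / 2" using h r by simp
  then obtain x where x: "0 \<le> x" "x \<le> h + r / 2" "w x = path_max w (h + r / 2)"
    by (rule path_max_attained)
  have wx: "a < w x" using exceeds[of "h + r / 2"] x r by simp
  have "h < x"
    using h(2) h(3)[of x] x(1) wx by (cases x h rule: linorder_cases) auto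
  interpret neg: continuous_path "\<lambda>x. - w x"
    by unfold_locales (intro continuous_intros cont)
  obtain d where d: "0 < d" "\<And>y. 0 \<le> y \<Longrightarrow> \<bar>y - x\<bar> < d \<Longrightarrow> - w y < - a"
    using neg.eventually_near[of x "- a"] x wx by auto
  have "\<forall>\<^sub>F N in sequentially. 1 / real (Suc N) < min d (r / 2)"
    using order_tendstoD(2)[OF LIMSEQ_inverse_real_of_nat, of "min d (r / 2)"] d r
    by (simp add: inverse_eq_divide)
  then show ?thesis
  proof eventually_elim
    case (elim N)
    let ?\<delta> = "1 / real (Suc N)"
    have \<delta>: "0 < ?\<delta>" by simp
    define k0 where "k0 = nat \<lceil>x * real (Suc N)\<rceil>"
    have "x * real (Suc N) \<le> real k0" "real k0 < x * real (Suc N) + 1"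
    proof -
      have "real k0 = of_int \<lceil>x * real (Suc N)\<rceil>" using x(1) by (simp add: k0_def)
      then show "x * real (Suc N) \<le> real k0" "real k0 < x * real (Suc N) + 1" by linarith+
    qed
    then have "x * real (Suc N) * ?\<delta> \<le> real k0 * ?\<delta>" "real k0 * ?\<delta> < (x * real (Suc N) + 1) * ?\<delta>"
      using \<delta> by (intro mult_right_mono mult_strict_right_mono; simp)+
    moreover have "x * real (Suc N) * ?\<delta> = x" "(x * real (Suc N) + 1) * ?\<delta> = x + ?\<delta>"
      by (simp_all add: add_divide_distrib del: of_nat_Suc)
    ultimately have k0: "x \<le> real k0 * ?\<delta>" "real k0 * ?\<delta> < x + ?\<delta>"
      by simp_all
    then have "a \<le> w (real k0 * ?\<delta>)"
      using d(2)[of "real k0 * ?\<delta>"] elim x(1) by auto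
    then have ex: "\<exists>k. a \<le> w (real k * ?\<delta>)" by blast
    define k where "k = (LEAST k. a \<le> w (real k * ?\<delta>))"
    have k: "a \<le> w (real k * ?\<delta>)" unfolding k_def by (rule LeastI_ex[OF ex])
    have before: "w (real j * ?\<delta>) < a" if "j < k" for j
      using not_less_Least[of j "\<lambda>k. a \<le> w (real k * ?\<delta>)"] that unfolding k_def by linarith
    have "k \<le> k0" unfolding k_def by (rule Least_le) fact
    then have "real k * ?\<delta> \<le> real k0 * ?\<delta>" by (intro mult_right_mono) auto
    then have "real k * ?\<delta> < h + r" using k0 elim x(2) by linarith
    moreover have "h \<le> real k * ?\<delta>"
      using h(3)[of "real k * ?\<delta>"] k by (meson \<delta> less_imp_le linorder_not_less mult_nonneg_nonneg of_nat_0_le_iff)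
    ultimately show ?case using k before by blast
  qed
qed

end

context standard_brownian_motion
begin

text \<open>
  Discretized strong Markov property. On a path that stays above \<open>a\<close> for a while after the first hit \<open>h\<close>,
  the first grid hit converges to \<open>h\<close> as the grid is refined, the path there is below \<open>a + e\<close> by
  continuity, and it drops by at most \<open>e\<close> at the test times \<open>t j\<close>. For every fine grid this is an event of
  probability at most \<open>\<kappa>\<close>.
\<close>

lemma AE_dips_below_after_first_hit:
  assumes a: "0 \<le> a"
  shows "AE \<omega> in M. \<forall>h d. 0 \<le> h \<longrightarrow> W h \<omega> = a \<longrightarrow> (\<forall>v. 0 \<le> v \<and> v < h \<longrightarrow> W v \<omega> < a) \<longrightarrow> 0 < d \<longrightarrow>
    (\<exists>v. h < v \<and> v < h + d \<and> W v \<omega> < a)"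
proof -
  define P where "P i \<omega> \<longleftrightarrow> (\<forall>h. 0 \<le> h \<longrightarrow> W h \<omega> = a \<longrightarrow> (\<forall>v. 0 \<le> v \<and> v < h \<longrightarrow> W v \<omega> < a) \<longrightarrow>
    (\<exists>v. h < v \<and> v < h + 1 / real (Suc i) \<and> W v \<omega> < a))" for i \<omega>
  have exceeds: "AE \<omega> in M. \<forall>q\<in>\<rat> \<inter> {0<..}. path_max (\<lambda>t. W t \<omega>) q \<noteq> a"
    using a countable_rat by (subst AE_ball_countable) (auto intro: AE_path_max_neq)
  have "AE \<omega> in M. P i \<omega>" for i
  proof (rule AE_if_eventually_in_small_events)
    fix \<kappa> :: real assume \<kappa>: "0 < \<kappa>"
    let ?d = "1 / real (Suc i)"
    have "0 < ?d / 2" by simp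
    from small_ball[OF this \<kappa>]
    obtain e m t where e: "0 < e" and t: "\<forall>j<m. t j \<le> t (Suc j)" "\<forall>j\<le>m. 0 < t j \<and> t j \<le> ?d / 2"
      and small: "\<forall>p\<ge>0. \<forall>c\<in>{1, -1}.
          prob {\<omega> \<in> space M. \<forall>j\<le>m. c * (W (p + t j) \<omega> - W p \<omega>) \<le> e} \<le> \<kappa>"
      by blast
    define E where "E N = {\<omega> \<in> space M. \<exists>k. (\<forall>j<k. W (real j * (1 / real (Suc N))) \<omega> - W 0 \<omega> < a) \<and>
      a \<le> W (real k * (1 / real (Suc N))) \<omega> - W 0 \<omega> \<and>
      (\<forall>j\<le>m. -1 * (W (real k * (1 / real (Suc N)) + t j) \<omega> - W (real k * (1 / real (Suc N))) \<omega>) \<le> e)}" for N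
    have t0: "0 \<le> t 0" using t(2) by (simp add: less_imp_le)
    have mono: "t j \<le> t (Suc j)" if "j < m" for j using t(1) that by blast
    have low: "prob {\<omega> \<in> space M. \<forall>j\<le>m. -1 * (W (p + t j) \<omega> - W p \<omega>) \<le> e} \<le> \<kappa>" if "0 \<le> p" for p
      using small that by blast
    have "E N \<in> events" "prob (E N) \<le> \<kappa>" for N
      unfolding E_def
      by (rule prob_stay_above_at_grid_hit[where t=t and m=m and e=e and \<delta>="1 / real (Suc N)"],
          simp, rule t0, erule mono, erule low)+
    moreover have "AE \<omega> in M. \<not> P i \<omega> \<longrightarrow> (\<forall>\<^sub>F N in sequentially. \<omega> \<in> E N)"
      using AE_space AE_continuous_path W_zero exceeds
    proof eventually_elim
      case (elim \<omega>)
      interpret continuous_path "\<lambda>t. W t \<omega>" by fact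
      show ?case
      proof
        assume "\<not> P i \<omega>"
        then obtain h where h: "0 \<le> h" "W h \<omega> = a" "\<And>v. 0 \<le> v \<Longrightarrow> v < h \<Longrightarrow> W v \<omega> < a"
          and no_dip: "\<not> (\<exists>v. h < v \<and> v < h + ?d \<and> W v \<omega> < a)"
          unfolding P_def by blast
        have stay: "a \<le> W v \<omega>" if "h < v" "v < h + ?d" for v
          using no_dip that not_le by blast
        have above: "a < path_max (\<lambda>t. W t \<omega>) x" if x: "h < x" for x
        proof -
          obtain q where q: "q \<in> \<rat>" "h < q" "q < x" using Rats_dense_in_real[OF x] by auto
          have "a \<le> path_max (\<lambda>t. W t \<omega>) q" using path_max_ge[of h q] h q by simp
          moreover have "path_max (\<lambda>t. W t \<omega>) q \<noteq> a" using elim(4) q h by auto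
          moreover have "path_max (\<lambda>t. W t \<omega>) q \<le> path_max (\<lambda>t. W t \<omega>) x"
            using q h by (intro path_max_mono) auto
          ultimately show ?thesis by simp
        qed
        have "W h \<omega> < a + e" using h e by simp
        from eventually_near[OF h(1) this]
        obtain d where d: "0 < d" "\<And>x. 0 \<le> x \<Longrightarrow> \<bar>x - h\<bar> < d \<Longrightarrow> W x \<omega> < a + e" by blast
        have "0 < min d (?d / 2)" using d by simp
        then have "\<forall>\<^sub>F N in sequentially. \<exists>k. (\<forall>j<k. W (real j * (1 / real (Suc N))) \<omega> < a) \<and>
            a \<le> W (real k * (1 / real (Suc N))) \<omega> \<and> h \<le> real k * (1 / real (Suc N)) \<and>
            real k * (1 / real (Suc N)) < h + min d (?d / 2)"
          by (intro first_grid_hit_near h above)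
        then show "\<forall>\<^sub>F N in sequentially. \<omega> \<in> E N"
        proof eventually_elim
          case (elim N)
          let ?\<delta> = "1 / real (Suc N)"
          from elim obtain k where k: "\<forall>j<k. W (real j * ?\<delta>) \<omega> < a" "a \<le> W (real k * ?\<delta>) \<omega>"
            "h \<le> real k * ?\<delta>" "real k * ?\<delta> < h + min d (?d / 2)" by blast
          have "-1 * (W (real k * ?\<delta> + t j) \<omega> - W (real k * ?\<delta>) \<omega>) \<le> e" if j: "j \<le> m" for j
          proof -
            have "0 < t j" "t j \<le> ?d / 2" using t(2) j by auto
            then have "a \<le> W (real k * ?\<delta> + t j) \<omega>"
              using k(3,4) by (intro stay) linarith+
            moreover have "W (real k * ?\<delta>) \<omega> < a + e"
              using k(3,4) h(1) by (intro d(2)) linarith+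
            ultimately show ?thesis by simp
          qed
          then show ?case
            unfolding E_def using k(1,2) \<open>\<omega> \<in> space M\<close> \<open>W 0 \<omega> = 0\<close> by (auto intro!: exI[of _ k])
        qed
      qed
    qed
    ultimately show "\<exists>E. (\<forall>N. E N \<in> events \<and> prob (E N) \<le> \<kappa>) \<and>
        (AE \<omega> in M. \<not> P i \<omega> \<longrightarrow> (\<forall>\<^sub>F N in sequentially. \<omega> \<in> E N))"
      by blast
  qed
  then have "AE \<omega> in M. \<forall>i. P i \<omega>" unfolding AE_all_countable by blast
  then show ?thesis
  proof eventually_elim
    case (elim \<omega>)
    show ?case
    proof (intro allI impI)
      fix h d :: real
      assume h: "0 \<le> h" "W h \<omega> = a" "\<forall>v. 0 \<le> v \<and> v < h \<longrightarrow> W v \<omega> < a" and "0 < d"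
      then obtain i where i: "1 / real (Suc i) < d" using nat_approx_posE by blast
      have "\<exists>v. h < v \<and> v < h + 1 / real (Suc i) \<and> W v \<omega> < a"
        using elim h unfolding P_def by blast
      then show "\<exists>v. h < v \<and> v < h + d \<and> W v \<omega> < a" using i by force
    qed
  qed
qed

end

section \<open>Convergence of the stopping times\<close>

context standard_brownian_motion
begin

text \<open>
  All exceptional levels, rational times and rational time triples are countable, so one null set
  covers every use of the path properties; on its complement the two one-sided estimates apply.
\<close>

lemma AE_barrier_time_tendsto:
  assumes cent: "\<And>n. centered (\<nu> n)" "centered \<mu>"
    and conv: "\<And>x. (\<lambda>n. call_price (\<nu> n) x) \<longlonglongrightarrow> call_price \<mu> x"
  shows "AE \<omega> in M. (\<lambda>n. barrier_time W (ay_beta (\<nu> n)) \<omega>) \<longlonglongrightarrow> barrier_time W (ay_beta \<mu>) \<omega>"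
proof -
  let ?S = "\<lambda>\<omega>. path_max (\<lambda>t. W t \<omega>)"
  define D where "D = {s. s = 0 \<or> call_sup \<mu> = ereal s \<or>
      (0 < s \<and> 0 < call_price \<mu> s \<and> \<not> isCont (ay_level \<mu>) s)}"
  have a0: "0 \<le> a" if "call_sup \<mu> = ereal a" for a
    using ereal_neg_less_call_sup[OF cent(2), of a] that by force
  have D0: "0 \<le> s" if "s \<in> D" for s using that a0 by (auto simp: D_def)
  have "countable {s. call_sup \<mu> = ereal s}" by (cases "call_sup \<mu>") auto
  then have "countable ({0} \<union> {s. call_sup \<mu> = ereal s} \<union>
      {s. 0 < s \<and> 0 < call_price \<mu> s \<and> \<not> isCont (ay_level \<mu>) s})"
    using countable_discontinuities_ay_level[OF cent(2)] by simp
  then have D: "countable D" by (rule countable_subset[rotated]) (auto simp: D_def)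
  have levels: "AE \<omega> in M. \<forall>x\<in>(\<rat> \<inter> {0<..}) \<times> D. ?S \<omega> (fst x) \<noteq> snd x"
  proof (subst AE_ball_countable)
    show "countable ((\<rat> \<inter> {0<..}) \<times> D)" using D countable_rat by (intro countable_SIGMA countable_Int1) auto
    show "\<forall>x\<in>(\<rat> \<inter> {0<..}) \<times> D. AE \<omega> in M. ?S \<omega> (fst x) \<noteq> snd x"
      using D0 by (auto intro!: AE_path_max_neq)
  qed
  have dips: "AE \<omega> in M. \<forall>a. call_sup \<mu> = ereal a \<longrightarrow> (\<forall>h d. 0 \<le> h \<longrightarrow> W h \<omega> = a \<longrightarrow>
      (\<forall>v. 0 \<le> v \<and> v < h \<longrightarrow> W v \<omega> < a) \<longrightarrow> 0 < d \<longrightarrow> (\<exists>v. h < v \<and> v < h + d \<and> W v \<omega> < a))"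
  proof (cases "\<exists>a. call_sup \<mu> = ereal a")
    case True
    then obtain a where a: "call_sup \<mu> = ereal a" by blast
    show ?thesis using AE_dips_below_after_first_hit[OF a0[OF a]] a by simp
  qed auto
  define T where "T = {(p, r, q). p \<in> \<rat> \<and> r \<in> \<rat> \<and> q \<in> \<rat> \<and> 0 \<le> p \<and> p < r \<and> r < (q :: real)}"
  have [measurable]: "ay_level \<mu> \<in> borel_measurable borel"
    by (rule borel_measurable_ay_level[OF cent(2)])
  have no_touch: "AE \<omega> in M. \<forall>(p, r, q)\<in>T. \<not> (\<lambda>N. ay_level \<mu> (grid_max (\<lambda>x. W x \<omega> - W 0 \<omega>) 0 p N)
      - (W p \<omega> - W 0 \<omega>) + grid_max (\<lambda>x. -1 * (W x \<omega> - W r \<omega>)) r q N) \<longlonglongrightarrow> W r \<omega> - W p \<omega>"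
  proof (subst AE_ball_countable)
    have "countable ((\<rat> :: real set) \<times> (\<rat> :: real set) \<times> (\<rat> :: real set))" using countable_rat by (intro countable_SIGMA) auto
    then show "countable T" by (rule countable_subset[rotated]) (auto simp: T_def)
    have F: "(\<lambda>(x, y, z). ay_level \<mu> x - y + z) \<in> borel_measurable (borel \<Otimes>\<^sub>M borel \<Otimes>\<^sub>M borel)"
      by measurable
    show "\<forall>x\<in>T. AE \<omega> in M. case x of (p, r, q) \<Rightarrow> \<not> (\<lambda>N. ay_level \<mu> (grid_max (\<lambda>x. W x \<omega> - W 0 \<omega>) 0 p N)
      - (W p \<omega> - W 0 \<omega>) + grid_max (\<lambda>x. -1 * (W x \<omega> - W r \<omega>)) r q N) \<longlonglongrightarrow> W r \<omega> - W p \<omega>"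
    proof
      fix x assume "x \<in> T"
      then obtain p r q where x: "x = (p, r, q)" "0 \<le> p" "p < r" "r \<le> q" by (auto simp: T_def)
      show "AE \<omega> in M. case x of (p, r, q) \<Rightarrow> \<not> (\<lambda>N. ay_level \<mu> (grid_max (\<lambda>x. W x \<omega> - W 0 \<omega>) 0 p N)
      - (W p \<omega> - W 0 \<omega>) + grid_max (\<lambda>x. -1 * (W x \<omega> - W r \<omega>)) r q N) \<longlonglongrightarrow> W r \<omega> - W p \<omega>"
        unfolding x(1) prod.case by (rule AE_increment_not_limit[OF x(2-4) F])
    qed
  qed
  show ?thesis using AE_continuous_path W_zero levels dips no_touch
  proof eventually_elim
    case (elim \<omega>)
    let ?w = "\<lambda>t. W t \<omega>"
    interpret continuous_path ?w by fact
    define \<tau> where "\<tau> \<beta> = barrier_time W \<beta> \<omega>" for \<beta>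
    have \<tau>: "\<tau> \<beta> = Inf (ereal ` {u. 0 \<le> u \<and> ereal (?w u) \<le> \<beta> (path_max ?w u)})" for \<beta>
      by (simp add: \<tau>_def barrier_time_def running_max_eq_path_max)
    have "(\<lambda>n. \<tau> (ay_beta (\<nu> n))) \<longlonglongrightarrow> \<tau> (ay_beta \<mu>)"
    proof (rule order_tendstoI)
      fix a assume a: "a < \<tau> (ay_beta \<mu>)"
      obtain b where b: "a < b" "b < \<tau> (ay_beta \<mu>)" using dense[OF a] by blast
      show "\<forall>\<^sub>F n in sequentially. a < \<tau> (ay_beta (\<nu> n))"
      proof (cases b)
        case (real t)
        have "ay_beta \<mu> (path_max ?w u) < ereal (?w u)" if u: "0 \<le> u" "u \<le> t" for u
        proof (rule ccontr)
          assume "\<not> ?thesis"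
          then have "\<tau> (ay_beta \<mu>) \<le> ereal u" unfolding \<tau> using u by (intro Inf_lower) auto
          also have "\<dots> \<le> b" using u real by simp
          finally show False using b by simp
        qed
        then have "\<forall>\<^sub>F n in sequentially. \<forall>u. 0 \<le> u \<and> u \<le> t \<longrightarrow> ay_beta (\<nu> n) (path_max ?w u) < ereal (?w u)"
          by (rule eventually_above_barrier[OF cent conv])
        then show ?thesis
        proof eventually_elim
          case (elim n)
          have "ereal t \<le> \<tau> (ay_beta (\<nu> n))"
            unfolding \<tau>
          proof (rule Inf_greatest, clarify)
            fix u assume "0 \<le> u" "ereal (?w u) \<le> ay_beta (\<nu> n) (path_max ?w u)"
            then show "ereal t \<le> ereal u" using elim by (meson ereal_less_eq(3) leD linear)
          qed
          then show ?case using b real by auto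
        qed
      next
        case MInf then show ?thesis using b by simp
      next
        case PInf then show ?thesis using b by simp
      qed
    next
      fix b assume "\<tau> (ay_beta \<mu>) < b"
      then obtain u where u: "0 \<le> u" "ereal (?w u) \<le> ay_beta \<mu> (path_max ?w u)" "ereal u < b"
        unfolding \<tau> Inf_less_iff by auto
      obtain c where c: "ereal u < ereal c" "ereal c < b"
        using ereal_dense2[OF u(3)] by blast
      have "\<forall>\<^sub>F n in sequentially. \<exists>v. 0 \<le> v \<and> v < c \<and> ereal (?w v) \<le> ay_beta (\<nu> n) (path_max ?w v)"
      proof (rule eventually_hits_barrier[OF cent conv _ _ _ _ u(1) _ u(2)])
        show "?w 0 = 0" by fact
        show "u < c" using c by simp
        show "path_max ?w q \<noteq> s" if "q \<in> \<rat>" "0 < q" "s = 0 \<or> call_sup \<mu> = ereal s \<or>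
          (0 < s \<and> 0 < call_price \<mu> s \<and> \<not> isCont (ay_level \<mu>) s)" for q s
          using elim(3) that unfolding D_def by force
        show "\<exists>v. h < v \<and> v < h + d \<and> ?w v < a" if "call_sup \<mu> = ereal a" "0 \<le> h" "?w h = a"
          "\<And>v. 0 \<le> v \<Longrightarrow> v < h \<Longrightarrow> ?w v < a" "0 < d" for h a d
          using elim(4) that by blast
        show "\<not> (\<lambda>N. ay_level \<mu> (grid_max (\<lambda>x. ?w x - ?w 0) 0 p N) - (?w p - ?w 0)
               + grid_max (\<lambda>x. ?w r - ?w x) r q N) \<longlonglongrightarrow> ?w r - ?w p"
          if "p \<in> \<rat>" "r \<in> \<rat>" "q \<in> \<rat>" "0 \<le> p" "p < r" "r < q" for p r q
        proof -
          have "(p, r, q) \<in> T" using that by (simp add: T_def)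
          with elim(5) show ?thesis by fastforce
        qed
      qed
      then show "\<forall>\<^sub>F n in sequentially. \<tau> (ay_beta (\<nu> n)) < b"
      proof eventually_elim
        case (elim n)
        then obtain v where v: "0 \<le> v" "v < c" "ereal (?w v) \<le> ay_beta (\<nu> n) (path_max ?w v)" by blast
        then have "\<tau> (ay_beta (\<nu> n)) \<le> ereal v" unfolding \<tau> by (intro Inf_lower) auto
        also have "\<dots> < ereal c" using v by simp
        finally show ?case using c by simp
      qed
    qed
    then show ?case by (simp add: \<tau>_def)
  qed
qed

end

theorem corollary4p3:
  fixes M :: "'a measure" and W :: "real \<Rightarrow> 'a \<Rightarrow> real"
    and \<mu> :: "real measure" and \<mu>s :: "nat \<Rightarrow> real measure"
  assumes "standard_brownian_motion M W"
    and "centered \<mu>" and "\<And>n. n \<ge> 1 \<Longrightarrow> centered (\<mu>s n)"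
    and "\<mu> \<noteq> return borel 0" and "\<And>n. n \<ge> 1 \<Longrightarrow> \<mu>s n \<noteq> return borel 0"
    and "weak_conv_m \<mu>s \<mu>"
    and "(\<lambda>n. \<integral>x. \<bar>x\<bar> \<partial>\<mu>s n) \<longlonglongrightarrow> (\<integral>x. \<bar>x\<bar> \<partial>\<mu>)"
  shows "AE \<omega> in M. (\<lambda>n. barrier_time W (ay_beta (\<mu>s n)) \<omega>)
           \<longlonglongrightarrow> barrier_time W (ay_beta \<mu>) \<omega>"
proof -
  interpret standard_brownian_motion M W by fact
  \<comment> \<open>Nothing is known about \<open>\<mu>s 0\<close>.\<close>
  let ?\<nu> = "\<lambda>n. \<mu>s (Suc n)"
  have cent: "centered (?\<nu> n)" for n using assms(3) by simp
  have weak: "weak_conv_m ?\<nu> \<mu>"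
    using assms(6) unfolding weak_conv_m_def weak_conv_def by (auto intro: LIMSEQ_Suc)
  have "(\<lambda>n. call_price (?\<nu> n) x) \<longlonglongrightarrow> call_price \<mu> x" for x
    by (rule call_price_tendsto[OF cent assms(2) weak LIMSEQ_Suc[OF assms(7)]])
  from AE_barrier_time_tendsto[OF cent assms(2) this]
  show ?thesis
    by eventually_elim (rule LIMSEQ_imp_Suc)
qed

end
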